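(* Let $\mathcal E$ be a Hilbert space, let $F_j:[B(\mathcal H)^n]_1\to B(\mathcal H)\bar\otimes_{min}B(\mathcal E)$, $j=1,\dots,m$, be free holomorphic functions with coefficients in $B(\mathcal E)$, and assume that $F:=(F_1,\dots,F_m)$ is a contractive free holomorphic function. If $X,Y\in[B(\mathcal H)^n]_1$, then $F(X)\overset H\sim F(Y)$ and $${\bf d}(F(X),F(Y))\le{\bf d}(X,Y),$$ where ${\bf d}$ is the pseudohyperbolic metric defined on the Harnack parts of the closed noncommutative unit ball.
   Context: $\mathcal H$ is a separable infinite dimensional Hilbert space. For a Hilbert space $\mathcal K$ and $X=(X_1,\dots,X_n)\in B(\mathcal K)^n$, $\|X\|=\|\sum_iX_iX_i^*\|^{1/2}$, $[B(\mathcal K)^n]_1=\{X:\|X\|<1\}$, $[B(\mathcal K)^n]_1^-=\{X:\|X\|\le1\}$. $\mathbb F_n^+$ is the unital free semigroup on $g_1,\dots,g_n$; for $\alpha=g_{i_1}\cdots g_{i_k}$ put $|\alpha|=k$, $X_\alpha=X_{i_1}\cdots X_{i_k}$ ($X_\alpha=I$ for the neutral element, of length $0$). A free holomorphic function on $[B(\mathcal H)^n]_1$ with coefficients in $B(\mathcal E)$ is a map $F_j(X)=\sum_{k=0}^\infty\sum_{|\alpha|=k}X_\alpha\otimes A_{(\alpha)}$ with $A_{(\alpha)}\in B(\mathcal E)$, the series in $k$ converging in operator norm for all $X\in[B(\mathcal H)^n]_1$ ($\bar\otimes_{min}$ is the spatial tensor product). $F=(F_1,\dots,F_m)$ is contractive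 if $\|F\|_\infty=\sup_{\|X\|<1}\|F(X)\|\le1$ (row norm), so that $F(X)\in[B(\mathcal H\otimes\mathcal E)^m]_1^-$. Let $N\in\mathbb N$ and $\mathcal K$ a Hilbert space (below: $N=n$, $\mathcal K=\mathcal H$ for $X,Y$; $N=m$, $\mathcal K=\mathcal H\otimes\mathcal E$ for $F(X),F(Y)$). For $A,B\in[B(\mathcal K)^N]_1^-$ and $c\ge1$, write $A\overset{H}{\underset{c}\sim}B$ if $$\frac1{c^2}\Re p(B_1,\dots,B_N)\le\Re p(A_1,\dots,A_N)\le c^2\,\Re p(B_1,\dots,B_N)$$ for every noncommutative polynomial $p$ in $N$ variables with coefficients in $M_{q\times q}$, $q\in\mathbb N$, such that $\Re p\ge0$ (i.e. $\Re p(Z)=\frac12(p(Z)+p(Z)^* )\ge0$ for all $Z\in[B(\mathcal H)^N]_1$). $A\overset H\sim B$ (Harnack equivalence) means that this holds for some $c\ge1$; equivalence classes are Harnack parts. The open ball $[B(\mathcal H)^n]_1$ is the Harnack part of $0$. For Harnack equivalent $A,B$, $$\omega(A,B)=\inf\{c\ge1:\ A\overset{H}{\underset{c}\sim}B\},\qquad {\bf d}(A,B)=\frac{\omega(A,B)^2-1}{\omega(A,B)^2+1}.$$ *)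

theory Defs
  imports "HOL-Analysis.Analysis"
begin

section \<open>Complex Hilbert spaces\<close>

text \<open>The inner product is linear in its first argument.  Positive definiteness is implied by the
  last axiom, since \<open>norm\<close> is a norm.\<close>

class chilbert_space = banach +
  fixes scaleC :: "complex \<Rightarrow> 'a \<Rightarrow> 'a"
    and cinner :: "'a \<Rightarrow> 'a \<Rightarrow> complex"
  assumes scaleC_add_right: "scaleC c (x + y) = scaleC c x + scaleC c y"
    and scaleC_add_left: "scaleC (c + d) x = scaleC c x + scaleC d x"
    and scaleC_scaleC: "scaleC c (scaleC d x) = scaleC (c * d) x"
    and scaleC_one: "scaleC 1 x = x"
    and scaleC_of_real: "scaleC (of_real r) x = scaleR r x"
    and cinner_commute: "cinner x y = cnj (cinner y x)"
    and cinner_add_left: "cinner (x + y) z = cinner x z + cinner y z"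
    and cinner_scaleC_left: "cinner (scaleC c x) y = c * cinner x y"
    and cinner_self: "cinner x x = of_real ((norm x)\<^sup>2)"

global_interpretation complex_vector: vector_space "scaleC :: complex \<Rightarrow> 'a \<Rightarrow> 'a::chilbert_space"
  defines cspan = complex_vector.span
  by unfold_locales (simp_all add: scaleC_add_right scaleC_add_left scaleC_scaleC scaleC_one)

definition infinite_dimensional :: "'h::chilbert_space itself \<Rightarrow> bool"
  where "infinite_dimensional _ \<longleftrightarrow> \<not> (\<exists>S::'h set. finite S \<and> cspan S = UNIV)"

lemma norm_scaleC: "norm (scaleC c x) = cmod c * norm (x::'a::chilbert_space)"
proof -
  have "complex_of_real ((norm (scaleC c x))\<^sup>2) = cinner (scaleC c x) (scaleC c x)"
    by (simp only: cinner_self)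
  also have "\<dots> = c * cnj (c * cinner x x)"
    by (metis cinner_commute cinner_scaleC_left)
  also have "\<dots> = complex_of_real ((cmod c * norm x)\<^sup>2)"
    by (simp add: cinner_self power_mult_distrib complex_norm_square del: of_real_power)
  finally have "(norm (scaleC c x))\<^sup>2 = (cmod c * norm x)\<^sup>2"
    by (simp only: of_real_eq_iff)
  then show ?thesis
    by (simp add: power2_eq_iff_nonneg)
qed

lemma bounded_linear_scaleC: "bounded_linear (scaleC c :: 'a \<Rightarrow> 'a::chilbert_space)"
proof (rule bounded_linear_intro)
  show "scaleC c (r *\<^sub>R x) = r *\<^sub>R scaleC c (x::'a)" for r x
    by (simp add: scaleC_scaleC mult.commute flip: scaleC_of_real)
  show "norm (scaleC c x) \<le> norm x * cmod c" for x :: 'a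
    by (simp add: norm_scaleC mult.commute)
qed (rule scaleC_add_right)


section \<open>Bounded operators\<close>

text \<open>\<open>B(K)\<close> consists of the complex linear elements of the type \<open>'k \<Rightarrow>\<^sub>L 'k\<close> of bounded
  real linear operators, whose library norm is the operator norm.\<close>

definition bounded_ops :: "('k::chilbert_space \<Rightarrow>\<^sub>L 'k) set"
  where "bounded_ops = {T. \<forall>c x. blinfun_apply T (scaleC c x) = scaleC c (blinfun_apply T x)}"

lift_definition op_scaleC :: "complex \<Rightarrow> ('k::chilbert_space \<Rightarrow>\<^sub>L 'k) \<Rightarrow> ('k \<Rightarrow>\<^sub>L 'k)"
  is "\<lambda>c T x. scaleC c (T x)"
  by (rule bounded_linear_compose[OF bounded_linear_scaleC])

definition adj :: "('k::chilbert_space \<Rightarrow>\<^sub>L 'k) \<Rightarrow> ('k \<Rightarrow>\<^sub>L 'k)"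
  where "adj T = (THE S. \<forall>x y. cinner (blinfun_apply T x) y = cinner x (blinfun_apply S y))"

text \<open>\<open>N\<close>-tuples of operators are families indexed by a finite type with \<open>N\<close> elements;
  the free semigroup on \<open>N\<close> generators is the type of lists over that index type.\<close>

primrec word_op :: "('n \<Rightarrow> 'k::chilbert_space \<Rightarrow>\<^sub>L 'k) \<Rightarrow> 'n list \<Rightarrow> ('k \<Rightarrow>\<^sub>L 'k)" where
  "word_op X [] = id_blinfun"
| "word_op X (i # \<alpha>) = X i o\<^sub>L word_op X \<alpha>"

definition row_norm :: "('n::finite \<Rightarrow> 'k::chilbert_space \<Rightarrow>\<^sub>L 'k) \<Rightarrow> real"
  where "row_norm X = sqrt (norm (\<Sum>i\<in>UNIV. X i o\<^sub>L adj (X i)))"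

definition op_ball :: "('n::finite \<Rightarrow> 'k::chilbert_space \<Rightarrow>\<^sub>L 'k) set"
  where "op_ball = {X. (\<forall>i. X i \<in> bounded_ops) \<and> row_norm X < 1}"

definition op_cball :: "('n::finite \<Rightarrow> 'k::chilbert_space \<Rightarrow>\<^sub>L 'k) set"
  where "op_cball = {X. (\<forall>i. X i \<in> bounded_ops) \<and> row_norm X \<le> 1}"


section \<open>Hilbert tensor products and free holomorphic functions\<close>

text \<open>\<open>tens\<close> exhibits \<open>'k\<close> as the Hilbert space tensor product of \<open>'h\<close> and \<open>'e\<close>,
  which is determined up to a unique unitary compatible with elementary tensors.\<close>

definition hilbert_tensor ::
    "('h::chilbert_space \<Rightarrow> 'e::chilbert_space \<Rightarrow> 'k::chilbert_space) \<Rightarrow> bool" where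
  "hilbert_tensor tens \<longleftrightarrow>
     (\<forall>x x' y. tens (x + x') y = tens x y + tens x' y) \<and>
     (\<forall>x y y'. tens x (y + y') = tens x y + tens x y') \<and>
     (\<forall>c x y. tens (scaleC c x) y = scaleC c (tens x y)) \<and>
     (\<forall>c x y. tens x (scaleC c y) = scaleC c (tens x y)) \<and>
     (\<forall>x x' y y'. cinner (tens x y) (tens x' y') = cinner x x' * cinner y y') \<and>
     closure (cspan {tens x y |x y. True}) = UNIV"

definition op_tensor ::
    "('h::chilbert_space \<Rightarrow> 'e::chilbert_space \<Rightarrow> 'k::chilbert_space) \<Rightarrow>
     ('h \<Rightarrow>\<^sub>L 'h) \<Rightarrow> ('e \<Rightarrow>\<^sub>L 'e) \<Rightarrow> ('k \<Rightarrow>\<^sub>L 'k)" where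
  "op_tensor tens T A = (THE S. S \<in> bounded_ops \<and>
     (\<forall>x y. blinfun_apply S (tens x y) = tens (blinfun_apply T x) (blinfun_apply A y)))"

text \<open>The values lie in the spatial tensor product of \<open>B(H)\<close> and \<open>B(E)\<close> automatically, this being
  the norm closed span of the operators \<open>op_tensor tens T A\<close>.\<close>

definition free_holomorphic ::
    "('h::chilbert_space \<Rightarrow> 'e::chilbert_space \<Rightarrow> 'k::chilbert_space) \<Rightarrow>
     (('n::finite \<Rightarrow> 'h \<Rightarrow>\<^sub>L 'h) \<Rightarrow> ('k \<Rightarrow>\<^sub>L 'k)) \<Rightarrow> bool" where
  "free_holomorphic tens G \<longleftrightarrow>
     (\<exists>A :: 'n list \<Rightarrow> 'e \<Rightarrow>\<^sub>L 'e. (\<forall>\<alpha>. A \<alpha> \<in> bounded_ops) \<and>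
        (\<forall>X\<in>op_ball. (\<lambda>k. \<Sum>\<alpha> | length \<alpha> = k. op_tensor tens (word_op X \<alpha>) (A \<alpha>)) sums G X))"

definition sup_row_norm ::
    "('m::finite \<Rightarrow> ('n::finite \<Rightarrow> 'h::chilbert_space \<Rightarrow>\<^sub>L 'h) \<Rightarrow> ('k::chilbert_space \<Rightarrow>\<^sub>L 'k)) \<Rightarrow> ereal"
  where "sup_row_norm F = (SUP X\<in>op_ball. ereal (row_norm (\<lambda>j. F j X)))"


section \<open>Noncommutative polynomials with matrix coefficients\<close>

text \<open>Elements of \<open>B(K) \<otimes> M\<^sub>q = M\<^sub>q(B(K))\<close> are operator matrices whose entries are those with
  indices below \<open>q\<close>; they act on \<open>K\<^sup>q\<close>.  Entries with other indices are irrelevant.\<close>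

definition mat_Re :: "(nat \<Rightarrow> nat \<Rightarrow> 'k::chilbert_space \<Rightarrow>\<^sub>L 'k) \<Rightarrow> (nat \<Rightarrow> nat \<Rightarrow> 'k \<Rightarrow>\<^sub>L 'k)"
  where "mat_Re M = (\<lambda>i j. (1/2) *\<^sub>R (M i j + adj (M j i)))"

definition mat_nonneg :: "nat \<Rightarrow> (nat \<Rightarrow> nat \<Rightarrow> 'k::chilbert_space \<Rightarrow>\<^sub>L 'k) \<Rightarrow> bool" where
  "mat_nonneg q M \<longleftrightarrow>
     (\<forall>\<xi>. (\<Sum>i<q. \<Sum>j<q. cinner (blinfun_apply (M i j) (\<xi> j)) (\<xi> i)) \<in> \<real>\<^sub>\<ge>\<^sub>0)"

definition mat_le ::
    "nat \<Rightarrow> (nat \<Rightarrow> nat \<Rightarrow> 'k::chilbert_space \<Rightarrow>\<^sub>L 'k) \<Rightarrow> (nat \<Rightarrow> nat \<Rightarrow> 'k \<Rightarrow>\<^sub>L 'k) \<Rightarrow> bool"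
  where "mat_le q M M' \<longleftrightarrow> mat_nonneg q (\<lambda>i j. M' i j - M i j)"

text \<open>A polynomial with coefficients in \<open>M\<^sub>q\<close> assigns to each word \<open>\<alpha>\<close> the matrix \<open>p \<alpha>\<close>, nonzero
  for finitely many words only.\<close>

type_synonym 'n mat_family = "'n list \<Rightarrow> nat \<Rightarrow> nat \<Rightarrow> complex"

definition poly_support :: "nat \<Rightarrow> 'n mat_family \<Rightarrow> 'n list set"
  where "poly_support q p = {\<alpha>. \<exists>i<q. \<exists>j<q. p \<alpha> i j \<noteq> 0}"

definition is_nc_poly :: "nat \<Rightarrow> 'n mat_family \<Rightarrow> bool"
  where "is_nc_poly q p \<longleftrightarrow> finite (poly_support q p)"

definition poly_eval ::
    "nat \<Rightarrow> 'n mat_family \<Rightarrow> ('n \<Rightarrow> 'k::chilbert_space \<Rightarrow>\<^sub>L 'k) \<Rightarrow> (nat \<Rightarrow> nat \<Rightarrow> 'k \<Rightarrow>\<^sub>L 'k)" where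
  "poly_eval q p A = (\<lambda>i j. \<Sum>\<alpha>\<in>poly_support q p. op_scaleC (p \<alpha> i j) (word_op A \<alpha>))"

definition poly_Re_nonneg :: "'h::chilbert_space itself \<Rightarrow> nat \<Rightarrow> 'n::finite mat_family \<Rightarrow> bool" where
  "poly_Re_nonneg _ q p \<longleftrightarrow>
     (\<forall>Z\<in>(op_ball :: ('n \<Rightarrow> 'h \<Rightarrow>\<^sub>L 'h) set). mat_nonneg q (mat_Re (poly_eval q p Z)))"


section \<open>Harnack equivalence\<close>

text \<open>The type argument is the space \<open>H\<close> on which positivity of \<open>Re p\<close> is tested; the tuples
  being compared may live on another Hilbert space.\<close>

definition harnack_dominated :: "'h::chilbert_space itself \<Rightarrow> real \<Rightarrow>
    ('n::finite \<Rightarrow> 'k::chilbert_space \<Rightarrow>\<^sub>L 'k) \<Rightarrow> ('n \<Rightarrow> 'k \<Rightarrow>\<^sub>L 'k) \<Rightarrow> bool" where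
  "harnack_dominated H c A B \<longleftrightarrow> A \<in> op_cball \<and> B \<in> op_cball \<and> c \<ge> 1 \<and>
     (\<forall>q p. is_nc_poly q p \<and> poly_Re_nonneg H q p \<longrightarrow>
        mat_le q (\<lambda>i j. (1 / c\<^sup>2) *\<^sub>R mat_Re (poly_eval q p B) i j) (mat_Re (poly_eval q p A)) \<and>
        mat_le q (mat_Re (poly_eval q p A)) (\<lambda>i j. c\<^sup>2 *\<^sub>R mat_Re (poly_eval q p B) i j))"

definition harnack_equivalent :: "'h::chilbert_space itself \<Rightarrow>
    ('n::finite \<Rightarrow> 'k::chilbert_space \<Rightarrow>\<^sub>L 'k) \<Rightarrow> ('n \<Rightarrow> 'k \<Rightarrow>\<^sub>L 'k) \<Rightarrow> bool"
  where "harnack_equivalent H A B \<longleftrightarrow> (\<exists>c\<ge>1. harnack_dominated H c A B)"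

definition harnack_omega :: "'h::chilbert_space itself \<Rightarrow>
    ('n::finite \<Rightarrow> 'k::chilbert_space \<Rightarrow>\<^sub>L 'k) \<Rightarrow> ('n \<Rightarrow> 'k \<Rightarrow>\<^sub>L 'k) \<Rightarrow> real"
  where "harnack_omega H A B = Inf {c. c \<ge> 1 \<and> harnack_dominated H c A B}"

definition pseudohyperbolic :: "'h::chilbert_space itself \<Rightarrow>
    ('n::finite \<Rightarrow> 'k::chilbert_space \<Rightarrow>\<^sub>L 'k) \<Rightarrow> ('n \<Rightarrow> 'k \<Rightarrow>\<^sub>L 'k) \<Rightarrow> real" where
  "pseudohyperbolic H A B =
     ((harnack_omega H A B)\<^sup>2 - 1) / ((harnack_omega H A B)\<^sup>2 + 1)"

end

theory Submission
  imports Defs "HOL-Complex_Analysis.Conformal_Mappings"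
begin

text \<open>
  The claim is that \<open>F\<close> maps \<open>X \<sim>\<^sub>c Y\<close> to \<open>F(X) \<sim>\<^sub>c F(Y)\<close> with the same constant \<open>c\<close>.  Then the set of
  admissible constants can only grow under \<open>F\<close>, its infimum \<open>\<omega>\<close> can only shrink, and \<open>d\<close> is
  increasing in \<open>\<omega>\<close>.  That there is an admissible constant for \<open>X, Y\<close> at all comes from the classical
  Harnack inequality on the disc, applied to \<open>z \<mapsto> \<langle>p(zRX)\<xi>, \<xi>\<rangle>\<close> with some \<open>R > 1\<close>: the values at
  \<open>z = 1/R\<close> and \<open>z = 0\<close> are comparable, and the value at \<open>0\<close> is the same for \<open>X\<close> and \<open>Y\<close>
  (\<open>op_ball_harnack_dominated\<close>).

  Let \<open>p\<close> be a polynomial with \<open>Re p \<ge> 0\<close>.  Then \<open>Re (p \<circ> F) \<ge> 0\<close> on the ball, so one would like to test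
  \<open>X \<sim>\<^sub>c Y\<close> on \<open>p \<circ> F\<close>.  Three obstacles have to be removed, because the test functions for \<open>X \<sim>\<^sub>c Y\<close>
  are polynomials with matrix coefficients, positive on the ball of \<open>H\<close>.

  First, \<open>p\<close> is known to be positive on the open ball of \<open>H\<close> but is evaluated at \<open>F(Z)\<close>, in the closed
  ball of \<open>H \<otimes> E\<close>.  A value \<open>\<langle>p(T)\<xi>, \<xi>\<rangle>\<close> involves only the finitely many vectors \<open>T\<^sub>\<alpha> \<xi>\<^sub>j\<close> with \<open>\<alpha>\<close> short;
  compressing \<open>T\<close> to their span and moving that span into \<open>H\<close> changes neither the value nor the
  row contractivity (\<open>poly_nonneg_on_cball\<close>).

  Second, \<open>F\<close> is an infinite series.  Its Fejer means
  \<open>\<Sum>\<^sub>k (1 - k/N) \<Sum>\<^bsub>|\<alpha>|=k\<^esub> Z\<^sub>\<alpha> \<otimes> A\<^sub>\<alpha>\<close>, summed over \<open>k < N\<close>, are averages of \<open>F(e\<^bsup>it\<^esup>Z)\<close> against a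
  positive kernel of mass \<open>1\<close>.  Hence they are again row contractions, while they are polynomials
  and converge to \<open>F(Z)\<close> in norm (\<open>fejer_mean_row_contraction\<close>, \<open>tendsto_fejer_mean\<close>).

  Third, for a Fejer mean \<open>G\<close> the polynomial \<open>p \<circ> G\<close> has coefficients in \<open>M\<^sub>q(B(E))\<close>.  On vectors
  \<open>\<xi>\<^sub>i = \<Sum>\<^sub>v \<eta>\<^sub>i\<^sub>v \<otimes> e\<^sub>v\<close> built from finitely many \<open>e\<^sub>1, ..., e\<^sub>r\<close> only the scalars \<open>\<langle>B e\<^sub>v, e\<^sub>u\<rangle>\<close> of a
  coefficient \<open>B\<close> matter, and they form a polynomial with coefficients in \<open>M\<^sub>q\<^sub>r\<close>
  (\<open>op_polynomial_matrix_compression\<close>).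

  So \<open>X \<sim>\<^sub>c Y\<close> gives the two inequalities for \<open>p(G(X))\<close> and \<open>p(G(Y))\<close> on a dense set of vectors
  (\<open>harnack_op_polynomial\<close>); letting \<open>N \<rightarrow> \<infinity>\<close> and then passing to arbitrary vectors proves
  \<open>F(X) \<sim>\<^sub>c F(Y)\<close> (\<open>harnack_dominated_free_holomorphic\<close>).
\<close>

section \<open>Complex inner products\<close>

lemma cinner_add_right: "cinner x (y + z) = cinner x y + cinner x (z::'a::chilbert_space)"
  by (metis cinner_add_left cinner_commute complex_cnj_add)

lemma cinner_scaleC_right: "cinner x (scaleC c y) = cnj c * cinner x (y::'a::chilbert_space)"
  by (metis cinner_commute cinner_scaleC_left complex_cnj_mult)

lemma scaleR_scaleC: "r *\<^sub>R x = scaleC (of_real r) (x::'a::chilbert_space)"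
  by (simp add: scaleC_of_real)

lemma scaleC_minus1: "scaleC (-1) x = - (x::'a::chilbert_space)"
  using scaleC_of_real[of "-1" x] by simp

lemma Re_cinner_self: "Re (cinner x x) = (norm (x::'a::chilbert_space))\<^sup>2"
  by (simp add: cinner_self)

lemma norm_add_sq:
  "(norm (x + y))\<^sup>2 = (norm x)\<^sup>2 + 2 * Re (cinner x y) + (norm (y::'a::chilbert_space))\<^sup>2"
proof -
  have "Re (cinner y x) = Re (cinner x y)"
    by (metis cinner_commute cnj.simps(1))
  then show ?thesis
    by (simp add: cinner_add_left cinner_add_right flip: Re_cinner_self)
qed

lemma Re_cinner_le_norm: "Re (cinner x y) \<le> norm x * norm (y::'a::chilbert_space)"
proof -
  have scale: "Re (cinner (s *\<^sub>R u) (t *\<^sub>R v)) = s * t * Re (cinner u v)" for s t and u v :: 'a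
    unfolding scaleR_scaleC by (simp add: cinner_scaleC_left cinner_scaleC_right)
  show ?thesis
  proof (cases "norm x = 0 \<or> norm y = 0")
    case True
    have "(norm (x + y))\<^sup>2 = (norm x)\<^sup>2 + (norm y)\<^sup>2" using True by auto
    then show ?thesis using norm_add_sq[of x y] True by auto
  next
    case False
    define a b where "a = norm x" and "b = norm y"
    have ab: "a > 0" "b > 0" using False by (auto simp: a_def b_def)
    have "(norm (b *\<^sub>R x + (- a) *\<^sub>R y))\<^sup>2
        = (b * a)\<^sup>2 + 2 * Re (cinner (b *\<^sub>R x) ((-a) *\<^sub>R y)) + (a * b)\<^sup>2"
      using ab by (subst norm_add_sq) (simp add: a_def b_def)
    also have "Re (cinner (b *\<^sub>R x) ((-a) *\<^sub>R y)) = - (a * b) * Re (cinner x y)"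
      using scale[of b x "- a" y] by simp
    finally have "0 \<le> (b * a)\<^sup>2 + 2 * (- (a * b) * Re (cinner x y)) + (a * b)\<^sup>2"
      by (metis zero_le_power2)
    also have "\<dots> = 2 * (a * b) * (a * b - Re (cinner x y))"
      by (simp add: power2_eq_square algebra_simps)
    finally have "0 \<le> 2 * (a * b) * (a * b - Re (cinner x y))" .
    moreover have "0 < 2 * (a * b)" using ab by simp
    ultimately have "0 \<le> a * b - Re (cinner x y)" by (metis not_le zero_le_mult_iff)
    then show ?thesis by (simp add: a_def b_def)
  qed
qed

lemma cmod_cinner_le_norm: "cmod (cinner x y) \<le> norm x * norm (y::'a::chilbert_space)"
proof -
  obtain c where c: "cmod c = 1" "c * cinner x y = of_real (cmod (cinner x y))"
  proof (cases "cinner x y = 0")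
    case True then show ?thesis using that[of 1] by simp
  next
    case False
    let ?w = "cinner x y"
    have "cnj ?w / of_real (cmod ?w) * ?w = of_real (cmod ?w)"
      using False complex_norm_square[of ?w] by (simp add: power2_eq_square mult.commute field_simps)
    then show ?thesis using False by (intro that[of "cnj ?w / of_real (cmod ?w)"]) (auto simp: norm_divide)
  qed
  have "cmod (cinner x y) = Re (cinner (scaleC c x) y)"
    using c by (simp add: cinner_scaleC_left)
  also have "\<dots> \<le> norm x * norm y"
    using Re_cinner_le_norm[of "scaleC c x" y] c by (simp add: norm_scaleC)
  finally show ?thesis .
qed

lemma bounded_bilinear_cinner: "bounded_bilinear (cinner :: 'a::chilbert_space \<Rightarrow> 'a \<Rightarrow> complex)"
proof
  show "\<exists>K. \<forall>a b. cmod (cinner a b) \<le> norm a * norm (b::'a) * K"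
    by (rule exI[of _ 1]) (simp add: cmod_cinner_le_norm)
qed (simp_all add: cinner_add_left cinner_add_right scaleR_scaleC cinner_scaleC_left
    cinner_scaleC_right scaleR_conv_of_real)

interpretation cinner: bounded_bilinear "cinner :: 'a::chilbert_space \<Rightarrow> 'a \<Rightarrow> complex"
  by (rule bounded_bilinear_cinner)

lemma bounded_bilinear_scaleC: "bounded_bilinear (scaleC :: complex \<Rightarrow> 'a \<Rightarrow> 'a::chilbert_space)"
proof
  show "\<exists>K. \<forall>a b. norm (scaleC a (b::'a)) \<le> norm a * norm b * K"
    by (rule exI[of _ 1]) (simp add: norm_scaleC)
qed (simp_all add: scaleC_add_left scaleC_add_right scaleR_scaleC scaleC_scaleC
    scaleR_conv_of_real mult.commute)

interpretation scaleC: bounded_bilinear "scaleC :: complex \<Rightarrow> 'a \<Rightarrow> 'a::chilbert_space"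
  by (rule bounded_bilinear_scaleC)

lemma cinner_ext_right:
  assumes "\<And>x. cinner x y = cinner x (z::'a::chilbert_space)"
  shows "y = z"
proof -
  have "cinner (y - z) (y - z) = 0"
    using assms[of "y - z"] by (simp add: cinner.diff_right)
  then show ?thesis by (simp add: cinner_self)
qed

text \<open>The representing vector is the minimiser of \<open>\<parallel>x\<parallel>\<^sup>2 - 2 Re \<phi>(x)\<close>, which is
  \<open>\<parallel>x - z\<parallel>\<^sup>2 - \<parallel>z\<parallel>\<^sup>2\<close> once \<open>\<phi> = \<langle>-, z\<rangle>\<close>.  A minimising sequence is Cauchy, and the first variation at its
  limit \<open>z\<close> gives the real part of the identity; the imaginary part follows by complex linearity.\<close>

lemma riesz_representation:
  fixes \<phi> :: "'a::chilbert_space \<Rightarrow> complex"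
  assumes "bounded_linear \<phi>" and clin: "\<And>c x. \<phi> (scaleC c x) = c * \<phi> x"
  obtains z where "\<And>x. \<phi> x = cinner x z"
proof -
  interpret bounded_linear \<phi> by fact
  define J where "J x = (norm x)\<^sup>2 - 2 * Re (\<phi> x)" for x :: 'a
  define K where "K = onorm \<phi>"
  have phi_le: "cmod (\<phi> x) \<le> K * norm x" for x
    unfolding K_def using assms(1) by (rule onorm)
  have J_ge: "- K\<^sup>2 \<le> J x" for x
  proof -
    have "Re (\<phi> x) \<le> K * norm x"
      using phi_le[of x] complex_Re_le_cmod[of "\<phi> x"] by linarith
    moreover have "0 \<le> (norm x - K)\<^sup>2" by simp
    ultimately show ?thesis by (simp add: J_def power2_eq_square algebra_simps)
  qed
  have bdd: "bdd_below (range J)" using J_ge by (auto intro!: bdd_belowI)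
  define m where "m = (INF x. J x)"
  have m_le: "m \<le> J x" for x unfolding m_def using bdd by (auto intro: cINF_lower)
  have "\<exists>x. J x < m + inverse (Suc n)" for n
    using cINF_less_iff[of UNIV J "m + inverse (Suc n)"] bdd by (auto simp: m_def)
  then obtain s where s: "\<And>n. J (s n) < m + inverse (Suc n)" by metis
  have Jcont: "continuous_on UNIV J"
    unfolding J_def by (intro continuous_intros continuous_on assms)
  \<comment> \<open>the parallelogram identity turns near-minimality into closeness\<close>
  have par: "(norm (x - y))\<^sup>2 = 2 * J x + 2 * J y - 4 * J ((1/2) *\<^sub>R (x + y))" for x y
  proof -
    have "(norm (x - y))\<^sup>2 = (norm x)\<^sup>2 - 2 * Re (cinner x y) + (norm y)\<^sup>2"
      using norm_add_sq[of x "- y"] by (simp add: cinner.minus_right)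
    moreover have "4 * (norm ((1/2) *\<^sub>R (x + y)))\<^sup>2 = (norm x)\<^sup>2 + 2 * Re (cinner x y) + (norm y)\<^sup>2"
      using norm_add_sq[of x y] by (simp add: power_mult_distrib power_divide)
    moreover have "\<phi> ((1/2) *\<^sub>R (x + y)) = (1/2) *\<^sub>R (\<phi> x + \<phi> y)"
      by (simp only: scaleR add)
    ultimately show ?thesis by (simp add: J_def) (simp add: field_simps)
  qed
  have "Cauchy s"
  proof (rule CauchyI)
    fix e :: real assume e: "e > 0"
    obtain M where M: "inverse (Suc M) < e\<^sup>2 / 4"
      using reals_Archimedean[of "e\<^sup>2 / 4"] e by auto
    have "norm (s a - s b) < e" if "a \<ge> M" "b \<ge> M" for a b
    proof -
      have "inverse (real (Suc a)) \<le> inverse (Suc M)" "inverse (real (Suc b)) \<le> inverse (Suc M)"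
        using that by auto
      then have "(norm (s a - s b))\<^sup>2 < e\<^sup>2"
        using par[of "s a" "s b"] s[of a] s[of b] m_le[of "(1/2) *\<^sub>R (s a + s b)"] M by linarith
      then show ?thesis using e by (simp add: power2_less_imp_less)
    qed
    then show "\<exists>M. \<forall>m\<ge>M. \<forall>n\<ge>M. norm (s m - s n) < e" by blast
  qed
  then obtain z where z: "s \<longlonglongrightarrow> z" using Cauchy_convergent convergent_def by blast
  have Jz: "J z \<le> m"
  proof -
    have "(\<lambda>n. J (s n)) \<longlonglongrightarrow> J z"
      using Jcont z by (auto simp: continuous_on_eq_continuous_at isCont_def intro: isCont_tendsto_compose)
    moreover have "(\<lambda>n. m + inverse (real (Suc n))) \<longlonglongrightarrow> m + 0"
      by (intro tendsto_intros LIMSEQ_inverse_real_of_nat)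
    ultimately show ?thesis
      using s by (intro LIMSEQ_le[of "\<lambda>n. J (s n)" "J z" "\<lambda>n. m + inverse (real (Suc n))" m])
        (auto intro: less_imp_le simp del: of_nat_Suc)
  qed
  have Re_eq: "Re (\<phi> v) = Re (cinner v z)" for v
  proof -
    define d where "d = Re (cinner z v) - Re (\<phi> v)"
    have ineq: "0 \<le> 2 * t * d + t\<^sup>2 * (norm v)\<^sup>2" for t :: real
    proof -
      have "J z \<le> J (z + t *\<^sub>R v)" using Jz m_le order_trans by blast
      moreover have "J (z + t *\<^sub>R v) = J z + 2 * t * d + t\<^sup>2 * (norm v)\<^sup>2"
        by (simp add: J_def norm_add_sq d_def add scaleR cinner.scaleR_right
            power_mult_distrib algebra_simps)
      ultimately show ?thesis by simp
    qed
    have "d = 0"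
    proof (rule ccontr)
      assume d: "d \<noteq> 0"
      \<comment> \<open>\<open>t = - d / N\<close> nearly minimises the quadratic in \<open>t\<close>; the \<open>+ 1\<close> covers \<open>v = 0\<close>\<close>
      define N where "N = (norm v)\<^sup>2 + 1"
      have N: "N > 0" "(norm v)\<^sup>2 < N" by (simp_all add: N_def add_nonneg_pos)
      have "0 \<le> 2 * (- d / N) * d + (- d / N)\<^sup>2 * (norm v)\<^sup>2" by (rule ineq)
      also have "\<dots> \<le> 2 * (- d / N) * d + (- d / N)\<^sup>2 * N"
        using N by (intro add_left_mono mult_left_mono) auto
      also have "\<dots> = - (d\<^sup>2 / N)" using N by (simp add: field_simps power2_eq_square)
      also have "\<dots> < 0" using d N by simp
      finally show False by simp
    qed
    moreover have "Re (cinner z v) = Re (cinner v z)" by (metis cinner_commute cnj.simps(1))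
    ultimately show ?thesis by (simp add: d_def)
  qed
  have "\<phi> x = cinner x z" for x
  proof (rule complex_eqI)
    show "Re (\<phi> x) = Re (cinner x z)" by (rule Re_eq)
    show "Im (\<phi> x) = Im (cinner x z)"
      using Re_eq[of "scaleC (- \<i>) x"] unfolding clin cinner_scaleC_left by simp
  qed
  then show ?thesis by (rule that)
qed

section \<open>Bounded operators and adjoints\<close>

lemma bounded_opsD: "T \<in> bounded_ops \<Longrightarrow> blinfun_apply T (scaleC c x) = scaleC c (blinfun_apply T x)"
  by (simp add: bounded_ops_def)

lemma exists_adjoint:
  assumes T: "T \<in> bounded_ops"
  obtains S where "S \<in> bounded_ops"
    "\<And>x y. cinner (blinfun_apply T x) y = cinner x (blinfun_apply S y)"
proof -
  have "\<exists>z. \<forall>x. cinner (blinfun_apply T x) y = cinner x z" for y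
  proof -
    have "bounded_linear (\<lambda>x. cinner (blinfun_apply T x) y)"
      by (intro bounded_linear_compose[OF cinner.bounded_linear_left] blinfun.bounded_linear_right)
    then show ?thesis
      by (rule riesz_representation) (auto simp: bounded_opsD[OF T] cinner_scaleC_left)
  qed
  then obtain S where S: "\<And>x y. cinner (blinfun_apply T x) y = cinner x (S y)" by metis
  have C: "S (scaleC c y) = scaleC c (S y)" for c y
    by (rule cinner_ext_right) (simp add: S[symmetric] cinner_scaleC_right)
  have "bounded_linear S"
  proof (rule bounded_linear_intro)
    show "S (x + y) = S x + S y" for x y
      by (rule cinner_ext_right) (simp add: S[symmetric] cinner_add_right)
    show "S (r *\<^sub>R y) = r *\<^sub>R S y" for r y by (simp add: scaleR_scaleC C)
    show "norm (S y) \<le> norm y * norm T" for y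
    proof -
      have "norm (S y) * norm (S y) = Re (cinner (blinfun_apply T (S y)) y)"
        by (simp add: S Re_cinner_self power2_eq_square)
      also have "\<dots> \<le> norm (blinfun_apply T (S y)) * norm y" by (rule Re_cinner_le_norm)
      also have "\<dots> \<le> (norm T * norm (S y)) * norm y"
        by (intro mult_right_mono norm_blinfun) auto
      finally have "norm (S y) * norm (S y) \<le> norm (S y) * (norm y * norm T)" by (simp add: mult_ac)
      then show ?thesis by (cases "norm (S y) = 0") (auto simp: mult_le_cancel_left)
    qed
  qed
  then have app: "blinfun_apply (Blinfun S) = S" by (rule bounded_linear_Blinfun_apply)
  show ?thesis
    by (rule that[of "Blinfun S"]) (simp_all add: app S C bounded_ops_def)
qed

lemma cinner_adj:
  assumes T: "T \<in> bounded_ops"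
  shows "cinner (blinfun_apply T x) y = cinner x (blinfun_apply (adj T) y)"
proof -
  obtain S where S: "S \<in> bounded_ops"
    "\<And>x y. cinner (blinfun_apply T x) y = cinner x (blinfun_apply S y)"
    using exists_adjoint[OF T] by metis
  have "adj T = S"
    unfolding adj_def
  proof (rule the_equality)
    show "S' = S" if "\<forall>x y. cinner (blinfun_apply T x) y = cinner x (blinfun_apply S' y)" for S'
      using that S(2) by (intro blinfun_eqI cinner_ext_right) metis
  qed (use S in auto)
  then show ?thesis using S by simp
qed

lemma id_bounded_ops: "id_blinfun \<in> bounded_ops"
  and compose_bounded_ops: "S \<in> bounded_ops \<Longrightarrow> T \<in> bounded_ops \<Longrightarrow> S o\<^sub>L T \<in> bounded_ops"
  and zero_bounded_ops: "0 \<in> bounded_ops"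
  and add_bounded_ops: "S \<in> bounded_ops \<Longrightarrow> T \<in> bounded_ops \<Longrightarrow> S + T \<in> bounded_ops"
  and scaleR_bounded_ops: "T \<in> bounded_ops \<Longrightarrow> r *\<^sub>R T \<in> bounded_ops"
  and op_scaleC_bounded_ops: "T \<in> bounded_ops \<Longrightarrow> op_scaleC c T \<in> bounded_ops"
  by (simp_all add: bounded_ops_def id_blinfun.rep_eq blinfun.add_left scaleC_add_right
      blinfun.scaleR_left scaleC.scaleR_right op_scaleC.rep_eq scaleC_scaleC mult.commute)

lemma sum_bounded_ops: "(\<And>i. i \<in> I \<Longrightarrow> T i \<in> bounded_ops) \<Longrightarrow> (\<Sum>i\<in>I. T i) \<in> bounded_ops"
  by (induction I rule: infinite_finite_induct) (auto simp: zero_bounded_ops add_bounded_ops)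

lemma word_op_bounded_ops: "(\<And>i. X i \<in> bounded_ops) \<Longrightarrow> word_op X \<alpha> \<in> bounded_ops"
  by (induction \<alpha>) (auto simp: id_bounded_ops compose_bounded_ops)

lemma closed_bounded_ops: "closed (bounded_ops :: ('k::chilbert_space \<Rightarrow>\<^sub>L 'k) set)"
proof -
  have eq: "(bounded_ops :: ('k \<Rightarrow>\<^sub>L 'k) set)
      = (\<Inter>c. \<Inter>x. {T. blinfun_apply T (scaleC c x) = scaleC c (blinfun_apply T x)})"
    by (auto simp: bounded_ops_def)
  have "continuous_on UNIV (\<lambda>T. blinfun_apply T x)" for x :: 'k
    by (intro linear_continuous_on blinfun.bounded_linear_left)
  then show ?thesis
    unfolding eq by (intro closed_INT ballI closed_Collect_eq scaleC.continuous_on continuous_intros)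
qed

lemma word_op_append: "word_op X (\<alpha> @ \<beta>) = word_op X \<alpha> o\<^sub>L word_op X \<beta>"
  by (induction \<alpha>) (auto intro!: blinfun_eqI)

lemma word_op_scaled:
  assumes X: "\<And>i. X i \<in> bounded_ops"
  shows "word_op (\<lambda>i. op_scaleC c (X i)) \<alpha> = op_scaleC (c ^ length \<alpha>) (word_op X \<alpha>)"
  by (induction \<alpha>)
     (auto intro!: blinfun_eqI simp: op_scaleC.rep_eq scaleC_one scaleC_scaleC bounded_opsD[OF X])


section \<open>Row contractions\<close>

text \<open>The norm bound on the row operator \<open>(X\<^sub>1, ..., X\<^sub>n) : K\<^sup>n \<rightarrow> K\<close>, stated without adjoints.\<close>

definition row_bound :: "real \<Rightarrow> ('n::finite \<Rightarrow> 'k::chilbert_space \<Rightarrow>\<^sub>L 'k) \<Rightarrow> bool"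
  where "row_bound b X \<longleftrightarrow>
    (\<forall>\<xi>. norm (\<Sum>i\<in>UNIV. blinfun_apply (X i) (\<xi> i)) \<le> b * L2_set (\<lambda>i. norm (\<xi> i)) UNIV)"

lemma le_of_sq_le_mult:
  fixes a c :: real
  assumes "a\<^sup>2 \<le> c * a" "0 \<le> c"
  shows "a \<le> c"
proof (rule ccontr)
  assume "\<not> a \<le> c"
  then have "c * a < a * a" using assms(2) by (intro mult_strict_right_mono) auto
  then show False using assms(1) by (simp add: power2_eq_square)
qed

text \<open>This is \<open>\<parallel>R R\<^sup>*\<parallel> = \<parallel>R\<parallel>\<^sup>2\<close> for the row operator \<open>R\<close>.  With \<open>S = \<Sum>\<^sub>i X\<^sub>i X\<^sub>i\<^sup>*\<close> and
  \<open>l(\<eta>) = \<parallel>R\<^sup>* \<eta>\<parallel>\<close> both directions rest on \<open>l(\<eta>)\<^sup>2 = \<langle>S\<eta>, \<eta>\<rangle>\<close>: a bound on \<open>S\<close> bounds \<open>R\<^sup>*\<close> and hence \<open>R\<close>,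
  and a bound on \<open>R\<close> gives \<open>\<parallel>S\<eta>\<parallel> \<le> b l(\<eta>)\<close>, hence \<open>l(\<eta>) \<le> b \<parallel>\<eta>\<parallel>\<close> and \<open>\<parallel>S\<parallel> \<le> b\<^sup>2\<close>.\<close>

lemma row_norm_le_iff:
  fixes X :: "'n::finite \<Rightarrow> 'k::chilbert_space \<Rightarrow>\<^sub>L 'k"
  assumes X: "\<And>i. X i \<in> bounded_ops" and b: "0 \<le> b"
  shows "row_norm X \<le> b \<longleftrightarrow> row_bound b X"
proof -
  define S where "S = (\<Sum>i\<in>UNIV. X i o\<^sub>L adj (X i))"
  define l where "l \<eta> = L2_set (\<lambda>i. norm (blinfun_apply (adj (X i)) \<eta>)) UNIV" for \<eta>
  have S_apply: "blinfun_apply S \<eta> = (\<Sum>i\<in>UNIV. blinfun_apply (X i) (blinfun_apply (adj (X i)) \<eta>))" for \<eta>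
    by (simp add: S_def blinfun.sum_left)
  have l_sq: "(l \<eta>)\<^sup>2 = Re (cinner (blinfun_apply S \<eta>) \<eta>)" for \<eta>
    by (simp add: l_def L2_set_def sum_nonneg S_apply cinner.sum_left cinner_adj[OF X] Re_cinner_self)
  have l_sq_le: "(l \<eta>)\<^sup>2 \<le> norm (blinfun_apply S \<eta>) * norm \<eta>" for \<eta>
    unfolding l_sq by (rule Re_cinner_le_norm)
  have row_norm: "row_norm X \<le> b \<longleftrightarrow> norm S \<le> b\<^sup>2"
    unfolding row_norm_def S_def[symmetric] using b real_sqrt_le_iff[of "norm S" "b\<^sup>2"] by simp
  show ?thesis
  proof
    assume "row_norm X \<le> b"
    then have S_le: "norm S \<le> b\<^sup>2" using row_norm by simp
    have l_le: "l \<eta> \<le> b * norm \<eta>" for \<eta>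
    proof -
      have "norm (blinfun_apply S \<eta>) * norm \<eta> \<le> (b\<^sup>2 * norm \<eta>) * norm \<eta>"
        using norm_blinfun[of S \<eta>] mult_right_mono[OF S_le, of "norm \<eta>"]
        by (intro mult_right_mono) auto
      then have "(l \<eta>)\<^sup>2 \<le> (b * norm \<eta>)\<^sup>2"
        using l_sq_le[of \<eta>] by (simp add: power2_eq_square mult_ac)
      then show ?thesis by (rule power2_le_imp_le) (simp add: b)
    qed
    show "row_bound b X"
      unfolding row_bound_def
    proof
      fix \<xi> :: "'n \<Rightarrow> 'k"
      define \<eta> where "\<eta> = (\<Sum>i\<in>UNIV. blinfun_apply (X i) (\<xi> i))"
      have "(norm \<eta>)\<^sup>2 = Re (cinner (\<Sum>i\<in>UNIV. blinfun_apply (X i) (\<xi> i)) \<eta>)"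
        by (simp add: Re_cinner_self flip: \<eta>_def)
      also have "\<dots> = (\<Sum>i\<in>UNIV. Re (cinner (\<xi> i) (blinfun_apply (adj (X i)) \<eta>)))"
        by (simp add: cinner.sum_left cinner_adj[OF X])
      also have "\<dots> \<le> (\<Sum>i\<in>UNIV. \<bar>norm (\<xi> i)\<bar> * \<bar>norm (blinfun_apply (adj (X i)) \<eta>)\<bar>)"
        by (intro sum_mono) (simp add: Re_cinner_le_norm)
      also have "\<dots> \<le> L2_set (\<lambda>i. norm (\<xi> i)) UNIV * l \<eta>"
        unfolding l_def by (rule L2_set_mult_ineq)
      also have "\<dots> \<le> L2_set (\<lambda>i. norm (\<xi> i)) UNIV * (b * norm \<eta>)"
        by (intro mult_left_mono l_le L2_set_nonneg)
      finally have "(norm \<eta>)\<^sup>2 \<le> (b * L2_set (\<lambda>i. norm (\<xi> i)) UNIV) * norm \<eta>"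
        by (simp add: mult_ac)
      then show "norm (\<Sum>i\<in>UNIV. blinfun_apply (X i) (\<xi> i)) \<le> b * L2_set (\<lambda>i. norm (\<xi> i)) UNIV"
        unfolding \<eta>_def[symmetric] by (rule le_of_sq_le_mult) (simp add: b L2_set_nonneg)
    qed
  next
    assume row: "row_bound b X"
    have "norm (blinfun_apply S \<eta>) \<le> b\<^sup>2 * norm \<eta>" for \<eta>
    proof -
      have S_le: "norm (blinfun_apply S \<eta>) \<le> b * l \<eta>"
        using row[unfolded row_bound_def, THEN spec, of "\<lambda>i. blinfun_apply (adj (X i)) \<eta>"]
        unfolding S_apply l_def .
      have "(l \<eta>)\<^sup>2 \<le> b * l \<eta> * norm \<eta>"
        using l_sq_le[of \<eta>] mult_right_mono[OF S_le norm_ge_zero[of \<eta>]] by linarith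
      also have "\<dots> = b * norm \<eta> * l \<eta>" by simp
      finally have "l \<eta> \<le> b * norm \<eta>" by (rule le_of_sq_le_mult) (simp add: b)
      then have "b * l \<eta> \<le> b * (b * norm \<eta>)" using b by (rule mult_left_mono)
      also have "\<dots> = b\<^sup>2 * norm \<eta>" by (simp add: power2_eq_square)
      finally show ?thesis using S_le by linarith
    qed
    then have "norm S \<le> b\<^sup>2" by (intro norm_blinfun_bound) auto
    then show "row_norm X \<le> b" using row_norm by simp
  qed
qed

lemma row_norm_nonneg: "0 \<le> row_norm X"
  by (simp add: row_norm_def)

lemma op_cball_iff: "X \<in> op_cball \<longleftrightarrow> (\<forall>i. X i \<in> bounded_ops) \<and> row_bound 1 X"
  using row_norm_le_iff[of X 1] by (auto simp: op_cball_def)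

lemma op_ball_iff:
  "X \<in> op_ball \<longleftrightarrow> (\<forall>i. X i \<in> bounded_ops) \<and> (\<exists>b. 0 \<le> b \<and> b < 1 \<and> row_bound b X)"
proof -
  have "row_norm X < 1 \<longleftrightarrow> (\<exists>b. 0 \<le> b \<and> b < 1 \<and> row_norm X \<le> b)"
    using row_norm_nonneg[of X] by (meson le_less_trans order_refl)
  then show ?thesis by (auto simp: op_ball_def row_norm_le_iff)
qed

lemma op_ball_subset_cball: "X \<in> op_ball \<Longrightarrow> X \<in> op_cball"
  by (simp add: op_ball_def op_cball_def)

lemma row_bound_scaled:
  assumes "row_bound b X" "b \<ge> 0"
  shows "row_bound (cmod c * b) (\<lambda>i. op_scaleC c (X i))"
  unfolding row_bound_def
proof
  fix \<xi> :: "'a \<Rightarrow> 'b"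
  have "norm (\<Sum>i\<in>UNIV. blinfun_apply (op_scaleC c (X i)) (\<xi> i))
      = cmod c * norm (\<Sum>i\<in>UNIV. blinfun_apply (X i) (\<xi> i))"
    by (simp add: op_scaleC.rep_eq norm_scaleC flip: scaleC.sum_right)
  also have "\<dots> \<le> cmod c * (b * L2_set (\<lambda>i. norm (\<xi> i)) UNIV)"
    using assms by (intro mult_left_mono) (auto simp: row_bound_def)
  finally show "norm (\<Sum>i\<in>UNIV. blinfun_apply (op_scaleC c (X i)) (\<xi> i))
      \<le> cmod c * b * L2_set (\<lambda>i. norm (\<xi> i)) UNIV" by (simp add: mult_ac)
qed

lemma scaled_in_op_ball:
  assumes "X \<in> op_cball" "cmod c < 1"
  shows "(\<lambda>i. op_scaleC c (X i)) \<in> op_ball"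
  using assms row_bound_scaled[of 1 X c]
  by (auto simp: op_cball_iff op_ball_iff op_scaleC_bounded_ops intro!: exI[of _ "cmod c"])

text \<open>The ball is defined by a strict inequality, so a point has room to be scaled by
  some \<open>R > 1\<close>.  This puts the unit circle inside the disc of convergence of \<open>z \<mapsto> F(zX)\<close>, and the
  point \<open>X\<close> inside the disc on which \<open>z \<mapsto> zRX\<close> stays in the ball.\<close>

lemma op_ball_expand:
  assumes "X \<in> op_ball"
  obtains R where "R > 1" "\<And>c. cmod c \<le> R \<Longrightarrow> (\<lambda>i. op_scaleC c (X i)) \<in> op_ball"
proof -
  obtain b where b: "0 \<le> b" "b < 1" "row_bound b X" and X: "\<And>i. X i \<in> bounded_ops"
    using assms by (auto simp: op_ball_iff)
  \<comment> \<open>strictly between \<open>1\<close> and \<open>1 / b\<close> if \<open>b > 0\<close>\<close>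
  define R where "R = 2 / (1 + b)"
  have R: "R > 1" "R * b < 1" using b by (auto simp: R_def field_simps)
  have "(\<lambda>i. op_scaleC c (X i)) \<in> op_ball" if c: "cmod c \<le> R" for c
  proof -
    have "cmod c * b \<le> R * b" using c b by (intro mult_right_mono) auto
    then show ?thesis
      using row_bound_scaled[OF b(3,1), of c] X R b
      by (auto simp: op_ball_iff op_scaleC_bounded_ops intro!: exI[of _ "cmod c * b"])
  qed
  then show ?thesis using R by (intro that) auto
qed


section \<open>Real parts of matrix polynomials as quadratic forms\<close>

definition mat_form :: "nat \<Rightarrow> (nat \<Rightarrow> nat \<Rightarrow> 'k::chilbert_space \<Rightarrow>\<^sub>L 'k) \<Rightarrow> (nat \<Rightarrow> 'k) \<Rightarrow> complex"
  where "mat_form q M \<xi> = (\<Sum>i<q. \<Sum>j<q. cinner (blinfun_apply (M i j) (\<xi> j)) (\<xi> i))"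

lemma mat_form_diff: "mat_form q (\<lambda>i j. M i j - M' i j) \<xi> = mat_form q M \<xi> - mat_form q M' \<xi>"
  by (simp add: mat_form_def blinfun.diff_left cinner.diff_left sum_subtractf)

lemma mat_form_scaleR: "mat_form q (\<lambda>i j. r *\<^sub>R M i j) \<xi> = of_real r * mat_form q M \<xi>"
  by (simp add: mat_form_def blinfun.scaleR_left cinner.scaleR_left sum_distrib_left scaleR_conv_of_real)

text \<open>The adjoint in \<open>mat_Re\<close> transposes the matrix, so its form is the complex conjugate after
  swapping the two summation indices.\<close>

lemma mat_form_Re:
  assumes M: "\<And>i j. M i j \<in> bounded_ops"
  shows "mat_form q (mat_Re M) \<xi> = of_real (Re (mat_form q M \<xi>))"
proof -
  have adj: "cinner (blinfun_apply (adj (M j i)) (\<xi> j)) (\<xi> i)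
      = cnj (cinner (blinfun_apply (M j i) (\<xi> i)) (\<xi> j))" for i j
    by (subst cinner_commute) (simp add: cinner_adj[OF M])
  have "mat_form q (mat_Re M) \<xi> = (1/2) *
      (mat_form q M \<xi> + (\<Sum>i<q. \<Sum>j<q. cnj (cinner (blinfun_apply (M j i) (\<xi> i)) (\<xi> j))))"
    by (simp add: mat_form_def mat_Re_def blinfun.scaleR_left blinfun.add_left cinner.scaleR_left
        cinner.add_left adj sum_distrib_left distrib_left sum.distrib scaleR_conv_of_real)
  also have "(\<Sum>i<q. \<Sum>j<q. cnj (cinner (blinfun_apply (M j i) (\<xi> i)) (\<xi> j))) = cnj (mat_form q M \<xi>)"
    unfolding mat_form_def cnj_sum by (rule sum.swap)
  finally show ?thesis by (simp add: complex_add_cnj)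
qed

lemma mat_nonneg_Re_iff:
  assumes "\<And>i j. M i j \<in> bounded_ops"
  shows "mat_nonneg q (mat_Re M) \<longleftrightarrow> (\<forall>\<xi>. 0 \<le> Re (mat_form q M \<xi>))"
proof -
  have "mat_nonneg q (mat_Re M) \<longleftrightarrow> (\<forall>\<xi>. mat_form q (mat_Re M) \<xi> \<in> \<real>\<^sub>\<ge>\<^sub>0)"
    by (simp add: mat_nonneg_def mat_form_def)
  then show ?thesis by (simp add: mat_form_Re[OF assms])
qed

lemma mat_le_scaled_Re_iff:
  assumes M: "\<And>i j. M i j \<in> bounded_ops" and M': "\<And>i j. M' i j \<in> bounded_ops"
  shows "mat_le q (\<lambda>i j. r *\<^sub>R mat_Re M i j) (\<lambda>i j. s *\<^sub>R mat_Re M' i j) \<longleftrightarrow>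
    (\<forall>\<xi>. r * Re (mat_form q M \<xi>) \<le> s * Re (mat_form q M' \<xi>))"
proof -
  have "mat_le q (\<lambda>i j. r *\<^sub>R mat_Re M i j) (\<lambda>i j. s *\<^sub>R mat_Re M' i j) \<longleftrightarrow>
      (\<forall>\<xi>. mat_form q (\<lambda>i j. s *\<^sub>R mat_Re M' i j - r *\<^sub>R mat_Re M i j) \<xi> \<in> \<real>\<^sub>\<ge>\<^sub>0)"
    by (simp add: mat_le_def mat_nonneg_def mat_form_def)
  also have "\<dots> \<longleftrightarrow> (\<forall>\<xi>. complex_of_real (s * Re (mat_form q M' \<xi>) - r * Re (mat_form q M \<xi>)) \<in> \<real>\<^sub>\<ge>\<^sub>0)"
    by (simp add: mat_form_diff mat_form_scaleR mat_form_Re M M')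
  finally show ?thesis unfolding nonneg_Reals_of_real_iff by simp
qed

lemma poly_eval_bounded_ops:
  "(\<And>i. A i \<in> bounded_ops) \<Longrightarrow> poly_eval q p A i j \<in> bounded_ops"
  by (auto simp: poly_eval_def intro!: sum_bounded_ops op_scaleC_bounded_ops word_op_bounded_ops)

lemma mat_form_poly_eval:
  "mat_form q (poly_eval q p A) \<xi> = (\<Sum>i<q. \<Sum>j<q. \<Sum>\<alpha>\<in>poly_support q p.
     p \<alpha> i j * cinner (blinfun_apply (word_op A \<alpha>) (\<xi> j)) (\<xi> i))"
  by (simp add: mat_form_def poly_eval_def blinfun.sum_left op_scaleC.rep_eq cinner.sum_left
      cinner_scaleC_left)

lemma poly_Re_nonneg_iff:
  "poly_Re_nonneg TYPE('h::chilbert_space) q p \<longleftrightarrow>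
    (\<forall>Z\<in>(op_ball :: ('n::finite \<Rightarrow> 'h \<Rightarrow>\<^sub>L 'h) set). \<forall>\<xi>. 0 \<le> Re (mat_form q (poly_eval q p Z) \<xi>))"
  unfolding poly_Re_nonneg_def
  by (intro ball_cong refl mat_nonneg_Re_iff poly_eval_bounded_ops) (simp add: op_ball_def)

text \<open>From here on adjoints have disappeared: both operator inequalities are inequalities
  between real parts of forms, which behave well under limits and compressions.\<close>

lemma harnack_dominated_iff:
  fixes A B :: "'n::finite \<Rightarrow> 'k::chilbert_space \<Rightarrow>\<^sub>L 'k"
  assumes A: "A \<in> op_cball" and B: "B \<in> op_cball"
  shows "harnack_dominated TYPE('h::chilbert_space) c A B \<longleftrightarrow> c \<ge> 1 \<and>
    (\<forall>q p \<xi>. is_nc_poly q p \<and> poly_Re_nonneg TYPE('h) q p \<longrightarrow>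
       Re (mat_form q (poly_eval q p B) \<xi>) / c\<^sup>2 \<le> Re (mat_form q (poly_eval q p A) \<xi>) \<and>
       Re (mat_form q (poly_eval q p A) \<xi>) \<le> c\<^sup>2 * Re (mat_form q (poly_eval q p B) \<xi>))"
proof -
  have bA: "poly_eval q p A i j \<in> bounded_ops" and bB: "poly_eval q p B i j \<in> bounded_ops" for q p i j
    using A B by (auto simp: op_cball_def intro!: poly_eval_bounded_ops)
  have "mat_le q (\<lambda>i j. (1 / c\<^sup>2) *\<^sub>R mat_Re (poly_eval q p B) i j) (mat_Re (poly_eval q p A)) \<longleftrightarrow>
      (\<forall>\<xi>. Re (mat_form q (poly_eval q p B) \<xi>) / c\<^sup>2 \<le> Re (mat_form q (poly_eval q p A) \<xi>))"
    and "mat_le q (mat_Re (poly_eval q p A)) (\<lambda>i j. c\<^sup>2 *\<^sub>R mat_Re (poly_eval q p B) i j) \<longleftrightarrow>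
      (\<forall>\<xi>. Re (mat_form q (poly_eval q p A) \<xi>) \<le> c\<^sup>2 * Re (mat_form q (poly_eval q p B) \<xi>))" for q p
    using mat_le_scaled_Re_iff[of "poly_eval q p B" "poly_eval q p A" q "1 / c\<^sup>2" 1, OF bB bA]
      mat_le_scaled_Re_iff[of "poly_eval q p A" "poly_eval q p B" q 1 "c\<^sup>2", OF bA bB] by simp_all
  then show ?thesis using A B by (auto simp: harnack_dominated_def)
qed

lemma tendsto_word_op:
  assumes "\<And>i. ((\<lambda>n. T n i) \<longlongrightarrow> S i) \<F>"
  shows "((\<lambda>n. word_op (T n) \<alpha>) \<longlongrightarrow> word_op S \<alpha>) \<F>"
  by (induction \<alpha>) (auto intro!: bounded_bilinear.tendsto[OF bounded_bilinear_blinfun_compose] assms)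

lemma tendsto_mat_form:
  assumes "\<And>i. ((\<lambda>n. T n i) \<longlongrightarrow> S i) \<F>" and "\<And>i. ((\<lambda>n. \<xi> n i) \<longlongrightarrow> \<zeta> i) \<F>"
  shows "((\<lambda>n. mat_form q (poly_eval q p (T n)) (\<xi> n)) \<longlongrightarrow> mat_form q (poly_eval q p S) \<zeta>) \<F>"
  unfolding mat_form_poly_eval
  by (intro tendsto_intros cinner.tendsto blinfun.tendsto tendsto_word_op assms)


section \<open>Finite orthonormal families\<close>

definition orthonormal_on :: "'i set \<Rightarrow> ('i \<Rightarrow> 'a::chilbert_space) \<Rightarrow> bool"
  where "orthonormal_on I f \<longleftrightarrow>
    finite I \<and> (\<forall>i\<in>I. \<forall>j\<in>I. cinner (f i) (f j) = (if i = j then 1 else 0))"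

abbreviation orthonormal :: "'a::chilbert_space set \<Rightarrow> bool"
  where "orthonormal U \<equiv> orthonormal_on U (\<lambda>u. u)"

definition expands_in :: "'a::chilbert_space set \<Rightarrow> 'a \<Rightarrow> bool"
  where "expands_in U x \<longleftrightarrow> x = (\<Sum>u\<in>U. scaleC (cinner x u) u)"

lemma orthonormal_onD: "orthonormal_on I f \<Longrightarrow> finite I"
  "orthonormal_on I f \<Longrightarrow> i \<in> I \<Longrightarrow> j \<in> I \<Longrightarrow> cinner (f i) (f j) = (if i = j then 1 else 0)"
  by (auto simp: orthonormal_on_def)

lemma cinner_sum_orthonormal:
  assumes "orthonormal_on I f" "i \<in> I"
  shows "cinner (\<Sum>j\<in>I. scaleC (c j) (f j)) (f i) = c i"
proof -
  have "cinner (\<Sum>j\<in>I. scaleC (c j) (f j)) (f i) = (\<Sum>j\<in>I. if j = i then c j else 0)"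
    unfolding cinner.sum_left
    by (intro sum.cong refl) (use assms in \<open>auto simp: cinner_scaleC_left orthonormal_onD\<close>)
  then show ?thesis using assms by (simp add: orthonormal_onD)
qed

text \<open>A vector in the span of \<open>U\<close> is orthogonal to the additional elements of \<open>V\<close>.\<close>

lemma expands_in_mono:
  assumes "expands_in U x" "orthonormal V" "U \<subseteq> V"
  shows "expands_in V x"
proof -
  have "cinner x v = 0" if v: "v \<in> V - U" for v
  proof -
    have "cinner x v = (\<Sum>u\<in>U. cinner x u * cinner u v)"
      by (subst assms(1)[unfolded expands_in_def]) (simp add: cinner.sum_left cinner_scaleC_left)
    also have "\<dots> = 0"
    proof (intro sum.neutral ballI)
      fix u assume "u \<in> U"
      then show "cinner x u * cinner u v = 0"
        using v assms(3) orthonormal_onD(2)[OF assms(2), of u v] by (auto dest: subsetD split: if_splits)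
    qed
    finally show ?thesis .
  qed
  then have "(\<Sum>u\<in>U. scaleC (cinner x u) u) = (\<Sum>u\<in>V. scaleC (cinner x u) u)"
    using orthonormal_onD(1)[OF assms(2)] assms(3) by (intro sum.mono_neutral_left) auto
  then show ?thesis using assms(1) by (simp add: expands_in_def)
qed

lemma gram_schmidt_step:
  assumes U: "orthonormal U" and x: "\<not> expands_in U x"
  obtains v where "v \<notin> U" "orthonormal (insert v U)" "expands_in (insert v U) x"
proof -
  define r where "r = x - (\<Sum>u\<in>U. scaleC (cinner x u) u)"
  define v where "v = (1 / norm r) *\<^sub>R r"
  have fin: "finite U" using U by (rule orthonormal_onD)
  have r: "norm r \<noteq> 0" using x by (auto simp: r_def expands_in_def)
  have r_orth: "cinner r u = 0" if "u \<in> U" for u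
    using cinner_sum_orthonormal[OF U that, of "cinner x"] by (simp add: r_def cinner.diff_left)
  have v_orth: "cinner v u = 0" "cinner u v = 0" if "u \<in> U" for u
  proof -
    show "cinner v u = 0" using r_orth[OF that] by (simp add: v_def cinner.scaleR_left)
    then show "cinner u v = 0" by (metis cinner_commute complex_cnj_zero)
  qed
  have vv: "cinner v v = 1" using r by (simp add: v_def cinner_self)
  have vU: "v \<notin> U" using v_orth vv by auto
  have onV: "orthonormal (insert v U)"
    using U vv v_orth by (auto simp: orthonormal_on_def)
  have "cinner r v = of_real (norm r)"
    using r by (simp add: v_def cinner.scaleR_right cinner_self power2_eq_square scaleR_conv_of_real)
  moreover have "cinner (\<Sum>u\<in>U. scaleC (cinner x u) u) v = 0"
    by (simp add: cinner.sum_left cinner_scaleC_left v_orth)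
  ultimately have "cinner x v = of_real (norm r)" by (simp add: r_def cinner.diff_left)
  then have "scaleC (cinner x v) v = r"
    using r by (simp add: scaleC_of_real v_def)
  then have "expands_in (insert v U) x"
    using vU fin by (simp add: expands_in_def) (simp add: r_def)
  then show ?thesis using that vU onV by blast
qed

lemma finite_orthonormal_basis:
  assumes "finite S"
  obtains U where "orthonormal U" "\<And>x. x \<in> S \<Longrightarrow> expands_in U x"
proof -
  have "\<exists>U. orthonormal U \<and> (\<forall>x\<in>S. expands_in U x)"
    using assms
  proof (induction S)
    case empty
    then show ?case by (intro exI[of _ "{}"]) (simp add: orthonormal_on_def)
  next
    case (insert x S)
    then obtain U where U: "orthonormal U" "\<forall>x\<in>S. expands_in U x" by blast
    show ?case
    proof (cases "expands_in U x")
      case False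
      obtain v where "orthonormal (insert v U)" "expands_in (insert v U) x"
        using gram_schmidt_step[OF U(1) False] by blast
      then show ?thesis using U expands_in_mono by blast
    qed (use U in auto)
  qed
  then show ?thesis using that by blast
qed

lemma orthonormal_of_any_card:
  assumes "infinite_dimensional TYPE('h::chilbert_space)"
  obtains U :: "'h::chilbert_space set" where "orthonormal U" "card U = n"
proof -
  have "\<exists>U :: 'h set. orthonormal U \<and> card U = n"
  proof (induction n)
    case 0
    show ?case by (intro exI[of _ "{}"]) (simp add: orthonormal_on_def)
  next
    case (Suc n)
    then obtain U :: "'h set" where U: "orthonormal U" "card U = n" by blast
    have fin: "finite U" using U by (auto dest: orthonormal_onD)
    then obtain x where x: "x \<notin> cspan U"
      using assms unfolding infinite_dimensional_def by blast
    have "(\<Sum>u\<in>U. scaleC (cinner x u) u) \<in> cspan U"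
      by (intro complex_vector.span_sum complex_vector.span_scale complex_vector.span_base)
    then have "\<not> expands_in U x" using x by (auto simp: expands_in_def)
    then obtain v where "v \<notin> U" "orthonormal (insert v U)"
      using gram_schmidt_step[OF U(1)] by blast
    then show ?case using U fin by (intro exI[of _ "insert v U"]) simp
  qed
  then show ?thesis using that by blast
qed

text \<open>The partial isometry between two Hilbert spaces that carries the orthonormal family \<open>f\<close>
  to \<open>g\<close> and kills the complement of \<open>f\<close>; its adjoint exchanges \<open>f\<close> and \<open>g\<close>.\<close>

definition transfer :: "'i set \<Rightarrow> ('i \<Rightarrow> 'a::chilbert_space) \<Rightarrow> ('i \<Rightarrow> 'b::chilbert_space) \<Rightarrow> 'a \<Rightarrow>\<^sub>L 'b"
  where "transfer I f g = Blinfun (\<lambda>x. \<Sum>i\<in>I. scaleC (cinner x (f i)) (g i))"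

lemma transfer_apply: "blinfun_apply (transfer I f g) x = (\<Sum>i\<in>I. scaleC (cinner x (f i)) (g i))"
  unfolding transfer_def
  by (subst bounded_linear_Blinfun_apply)
     (intro bounded_linear_sum bounded_linear_compose[OF scaleC.bounded_linear_left]
       cinner.bounded_linear_left refl)+

lemma transfer_scaleC: "blinfun_apply (transfer I f g) (scaleC c x) = scaleC c (blinfun_apply (transfer I f g) x)"
  by (simp add: transfer_apply cinner_scaleC_left scaleC.sum_right scaleC_scaleC)

lemma cinner_transfer: "cinner (blinfun_apply (transfer I f g) x) y = cinner x (blinfun_apply (transfer I g f) y)"
  by (simp add: transfer_apply cinner.sum_left cinner.sum_right cinner_scaleC_left
      cinner_scaleC_right mult.commute flip: cinner_commute)

lemma transfer_transfer:
  assumes "orthonormal_on I g"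
  shows "blinfun_apply (transfer I g f) (blinfun_apply (transfer I f g) x) = blinfun_apply (transfer I f f) x"
  using cinner_sum_orthonormal[OF assms, of _ "\<lambda>i. cinner x (f i)"]
  by (simp add: transfer_apply)

text \<open>Bessel's inequality is the case \<open>f = g\<close>, an orthogonal projection.  In general the norm of
  the image is that of the projection, since both squares equal \<open>\<langle>x, \<Sum>\<^sub>i \<langle>x, f\<^sub>i\<rangle> f\<^sub>i\<rangle>\<close>.\<close>

lemma norm_transfer_le:
  assumes f: "orthonormal_on I f" and g: "orthonormal_on I g"
  shows "norm (blinfun_apply (transfer I f g) x) \<le> norm x"
proof -
  have bessel: "norm (blinfun_apply (transfer I f f) x) \<le> norm x"
  proof -
    define y where "y = blinfun_apply (transfer I f f) x"
    have "(norm y)\<^sup>2 = Re (cinner x y)"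
      by (simp add: y_def cinner_transfer transfer_transfer[OF f] flip: Re_cinner_self)
    also have "\<dots> \<le> norm x * norm y" by (rule Re_cinner_le_norm)
    finally show ?thesis unfolding y_def by (rule le_of_sq_le_mult) simp
  qed
  have "(norm (blinfun_apply (transfer I f g) x))\<^sup>2 = Re (cinner x (blinfun_apply (transfer I f f) x))"
    by (simp add: cinner_transfer transfer_transfer[OF g] flip: Re_cinner_self)
  also have "\<dots> = Re (cinner (blinfun_apply (transfer I f f) x) (blinfun_apply (transfer I f f) x))"
    by (simp add: cinner_transfer transfer_transfer[OF f])
  also have "\<dots> = (norm (blinfun_apply (transfer I f f) x))\<^sup>2" by (rule Re_cinner_self)
  also have "\<dots> \<le> (norm x)\<^sup>2" using bessel by (simp add: power_mono)
  finally show ?thesis by (rule power2_le_imp_le) simp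
qed


section \<open>Positivity on the ball of one infinite dimensional space\<close>

text \<open>Let \<open>M\<close> be the span of all \<open>T\<^sub>\<beta> x\<close> with \<open>x \<in> S\<close> and \<open>\<beta>\<close> not longer than the words in \<open>W\<close>.
  The compression of \<open>T\<close> to \<open>M\<close> acts on \<open>x\<close> by these words exactly as \<open>T\<close> does, since every
  intermediate vector \<open>T\<^sub>\<beta> x\<close> stays in \<open>M\<close>.  As \<open>M\<close> is finite dimensional it embeds isometrically into
  the infinite dimensional space \<open>H\<close>, where the compression is extended by zero.\<close>

lemma compress_row:
  fixes T :: "'n::finite \<Rightarrow> 'k::chilbert_space \<Rightarrow>\<^sub>L 'k"
  assumes inf: "infinite_dimensional TYPE('h::chilbert_space)"
    and T: "\<And>i. T i \<in> bounded_ops" "row_bound b T" "0 \<le> b"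
    and fin: "finite W" "finite S"
  obtains Z :: "'n \<Rightarrow> 'h::chilbert_space \<Rightarrow>\<^sub>L 'h" and V
  where "\<And>i. Z i \<in> bounded_ops" "row_bound b Z"
    "\<And>\<alpha> x y. \<alpha> \<in> W \<Longrightarrow> x \<in> S \<Longrightarrow> y \<in> S \<Longrightarrow>
      cinner (blinfun_apply (word_op Z \<alpha>) (V x)) (V y) = cinner (blinfun_apply (word_op T \<alpha>) x) y"
proof -
  define D where "D = Max (insert 0 (length ` W))"
  have D: "length \<alpha> \<le> D" if "\<alpha> \<in> W" for \<alpha>
    using that fin by (auto simp: D_def intro!: Max_ge)
  define W' :: "'n list set" where "W' = {\<beta>. length \<beta> \<le> D}"
  have "finite W'" using finite_lists_length_le[of "UNIV :: 'n set" D] by (simp add: W'_def)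
  then obtain U where U: "orthonormal U"
    and exp: "\<And>z. z \<in> (\<lambda>(\<beta>, x). blinfun_apply (word_op T \<beta>) x) ` (W' \<times> S) \<Longrightarrow> expands_in U z"
    using finite_orthonormal_basis fin by (metis finite_cartesian_product finite_imageI)
  obtain O' :: "'h set" where O': "orthonormal O'" "card O' = card U"
    using orthonormal_of_any_card[OF inf] by blast
  then obtain f where f: "bij_betw f U O'"
    using U by (metis finite_same_card_bij orthonormal_onD(1))
  have onf: "orthonormal_on U f"
    using U O' f unfolding orthonormal_on_def bij_betw_def inj_on_def by auto
  define J where "J = transfer U (\<lambda>u. u) f"
  define J' where "J' = transfer U f (\<lambda>u. u)"
  have J'J: "blinfun_apply J' (blinfun_apply J (blinfun_apply (word_op T \<beta>) x)) = blinfun_apply (word_op T \<beta>) x"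
    if "length \<beta> \<le> D" "x \<in> S" for \<beta> x
    using exp[of "blinfun_apply (word_op T \<beta>) x"] that
    unfolding J_def J'_def transfer_transfer[OF onf] by (force simp: W'_def expands_in_def transfer_apply)
  define Z where "Z i = J o\<^sub>L T i o\<^sub>L J'" for i
  have "Z i \<in> bounded_ops" for i
    using T(1)[of i] by (simp add: Z_def bounded_ops_def J_def J'_def transfer_scaleC)
  moreover have "row_bound b Z"
    unfolding row_bound_def
  proof
    fix \<xi> :: "'n \<Rightarrow> 'h"
    have "(\<Sum>i\<in>UNIV. blinfun_apply (Z i) (\<xi> i))
        = blinfun_apply J (\<Sum>i\<in>UNIV. blinfun_apply (T i) (blinfun_apply J' (\<xi> i)))"
      by (simp add: Z_def blinfun.sum_right)
    also have "norm \<dots> \<le> norm (\<Sum>i\<in>UNIV. blinfun_apply (T i) (blinfun_apply J' (\<xi> i)))"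
      unfolding J_def by (rule norm_transfer_le[OF U onf])
    also have "\<dots> \<le> b * L2_set (\<lambda>i. norm (blinfun_apply J' (\<xi> i))) UNIV"
      using T(2)[unfolded row_bound_def, THEN spec, of "\<lambda>i. blinfun_apply J' (\<xi> i)"] by simp
    also have "\<dots> \<le> b * L2_set (\<lambda>i. norm (\<xi> i)) UNIV"
      using norm_transfer_le[OF onf U] T(3) by (intro mult_left_mono L2_set_mono) (auto simp: J'_def)
    finally show "norm (\<Sum>i\<in>UNIV. blinfun_apply (Z i) (\<xi> i)) \<le> b * L2_set (\<lambda>i. norm (\<xi> i)) UNIV" .
  qed
  moreover have "cinner (blinfun_apply (word_op Z \<alpha>) (blinfun_apply J x)) (blinfun_apply J y)
      = cinner (blinfun_apply (word_op T \<alpha>) x) y" if \<alpha>: "\<alpha> \<in> W" and xy: "x \<in> S" "y \<in> S" for \<alpha> x y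
  proof -
    have "blinfun_apply (word_op Z \<beta>) (blinfun_apply J x) = blinfun_apply J (blinfun_apply (word_op T \<beta>) x)"
      if "length \<beta> \<le> D" for \<beta>
      using that
    proof (induction \<beta>)
      case (Cons i \<beta>)
      then show ?case using J'J[of \<beta> x] xy by (simp add: Z_def)
    qed simp
    moreover have "blinfun_apply J' (blinfun_apply J y) = y" using J'J[of "[]" y] xy by simp
    ultimately show ?thesis using D[OF \<alpha>]
      by (simp add: J_def J'_def cinner_transfer)
  qed
  ultimately show ?thesis by (rule that)
qed

text \<open>Strict row contractions on \<open>K\<close> are compressed into \<open>H\<close>; the boundary is reached by
  \<open>rT \<rightarrow> T\<close> as \<open>r \<rightarrow> 1\<close>.\<close>

lemma poly_nonneg_on_cball:
  fixes T :: "'n::finite \<Rightarrow> 'k::chilbert_space \<Rightarrow>\<^sub>L 'k"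
  assumes inf: "infinite_dimensional TYPE('h::chilbert_space)"
    and p: "is_nc_poly q p" "poly_Re_nonneg TYPE('h::chilbert_space) q p"
    and T: "T \<in> op_cball"
  shows "0 \<le> Re (mat_form q (poly_eval q p T) \<xi>)"
proof -
  have strict: "0 \<le> Re (mat_form q (poly_eval q p T) \<xi>)" if T_ball: "T \<in> op_ball" for T :: "'n \<Rightarrow> 'k \<Rightarrow>\<^sub>L 'k"
  proof -
    obtain b where b: "\<And>i. T i \<in> bounded_ops" "0 \<le> b" "b < 1" "row_bound b T"
      using T_ball unfolding op_ball_iff by blast
    have fin: "finite (poly_support q p)" "finite (\<xi> ` {..<q})" using p by (auto simp: is_nc_poly_def)
    obtain Z :: "'n \<Rightarrow> 'h \<Rightarrow>\<^sub>L 'h" and V where Z: "\<And>i. Z i \<in> bounded_ops" "row_bound b Z"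
      "\<And>\<alpha> x y. \<alpha> \<in> poly_support q p \<Longrightarrow> x \<in> \<xi> ` {..<q} \<Longrightarrow> y \<in> \<xi> ` {..<q} \<Longrightarrow>
        cinner (blinfun_apply (word_op Z \<alpha>) (V x)) (V y) = cinner (blinfun_apply (word_op T \<alpha>) x) y"
      using compress_row[OF inf b(1,4,2) fin] by metis
    have "mat_form q (poly_eval q p T) \<xi> = mat_form q (poly_eval q p Z) (\<lambda>i. V (\<xi> i))"
      unfolding mat_form_poly_eval by (intro sum.cong refl) (simp add: Z(3))
    moreover have "Z \<in> op_ball" using Z b by (auto simp: op_ball_iff)
    ultimately show ?thesis using p(2) by (simp add: poly_Re_nonneg_iff)
  qed
  define r where "r n = 1 - inverse (real (Suc n))" for n
  define Tr where "Tr n i = op_scaleC (of_real (r n)) (T i)" for n i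
  have r: "r \<longlonglongrightarrow> 1"
    using tendsto_diff[OF tendsto_const LIMSEQ_inverse_real_of_nat, of "1::real"] by (simp add: r_def[abs_def])
  have Tr_eq: "Tr n i = r n *\<^sub>R T i" for n i
    by (rule blinfun_eqI) (simp add: Tr_def op_scaleC.rep_eq scaleC_of_real blinfun.scaleR_left)
  have "(\<lambda>n. Tr n i) \<longlonglongrightarrow> T i" for i
    using tendsto_scaleR[OF r tendsto_const, of "T i"] by (simp add: Tr_eq)
  then have "(\<lambda>n. Re (mat_form q (poly_eval q p (Tr n)) \<xi>)) \<longlonglongrightarrow> Re (mat_form q (poly_eval q p T) \<xi>)"
    by (intro tendsto_Re tendsto_mat_form tendsto_const) auto
  moreover have "0 \<le> Re (mat_form q (poly_eval q p (Tr n)) \<xi>)" for n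
  proof (rule strict)
    show "Tr n \<in> op_ball" unfolding Tr_def[abs_def]
      by (intro scaled_in_op_ball T) (simp only: norm_of_real, simp add: r_def field_simps)
  qed
  ultimately show ?thesis by (intro LIMSEQ_le_const) auto
qed


section \<open>Tensor products of operators\<close>

text \<open>Extension of a densely defined bounded operator, given by its graph \<open>R\<close> so that no
  well-definedness has to be checked beforehand: the bound makes the closure of \<open>R\<close> single-valued,
  and completeness makes it total.\<close>

lemma extend_bounded_relation:
  fixes R :: "('k::chilbert_space \<times> 'k) set"
  assumes add: "\<And>p q. p \<in> R \<Longrightarrow> q \<in> R \<Longrightarrow> p + q \<in> R"
    and scale: "\<And>c s t. (s, t) \<in> R \<Longrightarrow> (scaleC c s, scaleC c t) \<in> R"
    and bound: "\<And>s t. (s, t) \<in> R \<Longrightarrow> norm t \<le> C * norm s"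
    and dense: "closure (fst ` R) = UNIV"
  shows "\<exists>S\<in>bounded_ops. \<forall>s t. (s, t) \<in> R \<longrightarrow> blinfun_apply S s = t"
proof -
  define G where "G = closure R"
  have add_G: "p + q \<in> G" if "p \<in> G" "q \<in> G" for p q
  proof -
    obtain \<sigma> \<tau> where "\<And>n. \<sigma> n \<in> R" "\<sigma> \<longlonglongrightarrow> p" "\<And>n. \<tau> n \<in> R" "\<tau> \<longlonglongrightarrow> q"
      using \<open>p \<in> G\<close> \<open>q \<in> G\<close> unfolding G_def closure_sequential by metis
    then show ?thesis
      unfolding G_def closure_sequential
      by (intro exI[of _ "\<lambda>n. \<sigma> n + \<tau> n"]) (auto intro: add tendsto_add)
  qed
  have scale_G: "(scaleC c s, scaleC c t) \<in> G" if st: "(s, t) \<in> G" for c s t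
  proof -
    obtain \<sigma> where \<sigma>: "\<And>n. \<sigma> n \<in> R" "\<sigma> \<longlonglongrightarrow> (s, t)"
      using st unfolding G_def closure_sequential by metis
    have "(\<lambda>n. (scaleC c (fst (\<sigma> n)), scaleC c (snd (\<sigma> n)))) \<longlonglongrightarrow> (scaleC c s, scaleC c t)"
      using tendsto_fst[OF \<sigma>(2)] tendsto_snd[OF \<sigma>(2)]
      by (intro tendsto_Pair scaleC.tendsto tendsto_const) auto
    then show ?thesis
      unfolding G_def closure_sequential using \<sigma>(1) scale
      by (intro exI[of _ "\<lambda>n. (scaleC c (fst (\<sigma> n)), scaleC c (snd (\<sigma> n)))"]) auto
  qed
  have bound_G: "norm t \<le> C * norm s" if "(s, t) \<in> G" for s t
  proof -
    have "closed {p :: 'k \<times> 'k. norm (snd p) \<le> C * norm (fst p)}"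
      by (intro closed_Collect_le continuous_intros)
    then have "G \<subseteq> {p. norm (snd p) \<le> C * norm (fst p)}"
      unfolding G_def using bound by (intro closure_minimal) auto
    then show ?thesis using that by auto
  qed
  have diff_G: "(s - s', t - t') \<in> G" if "(s, t) \<in> G" "(s', t') \<in> G" for s t s' t'
    using add_G[OF that(1) scale_G[OF that(2), of "-1"]] by (simp add: scaleC_minus1)
  have uniq: "t = t'" if "(s, t) \<in> G" "(s, t') \<in> G" for s t t'
    using bound_G[OF diff_G[OF that]] by simp
  have R_G: "p \<in> G" if "p \<in> R" for p using that closure_subset by (auto simp: G_def)
  have total: "\<exists>t. (s, t) \<in> G" for s
  proof -
    obtain \<sigma> where \<sigma>: "\<And>n. \<sigma> n \<in> fst ` R" "\<sigma> \<longlonglongrightarrow> s"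
      using dense closure_sequential[of s "fst ` R"] by auto
    then have "\<exists>t. (\<sigma> n, t) \<in> R" for n by force
    then obtain \<tau> where \<tau>: "\<And>n. (\<sigma> n, \<tau> n) \<in> R" by metis
    have "Cauchy \<tau>"
    proof (rule CauchyI)
      fix e :: real assume "e > 0"
      define e' where "e' = e / (\<bar>C\<bar> + 1)"
      have e': "e' > 0" "\<bar>C\<bar> * e' < e" using \<open>e > 0\<close> by (auto simp: e'_def field_simps add_pos_nonneg)
      obtain M where M: "\<And>m n. m \<ge> M \<Longrightarrow> n \<ge> M \<Longrightarrow> norm (\<sigma> m - \<sigma> n) < e'"
        using CauchyD[OF LIMSEQ_imp_Cauchy[OF \<sigma>(2)] e'(1)] by blast
      have "norm (\<tau> m - \<tau> n) < e" if "m \<ge> M" "n \<ge> M" for m n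
      proof -
        have "norm (\<tau> m - \<tau> n) \<le> C * norm (\<sigma> m - \<sigma> n)"
          by (intro bound_G diff_G R_G \<tau>)
        also have "\<dots> \<le> \<bar>C\<bar> * norm (\<sigma> m - \<sigma> n)" by (intro mult_right_mono) auto
        also have "\<dots> \<le> \<bar>C\<bar> * e'" using M[OF that] by (intro mult_left_mono) auto
        finally show ?thesis using e'(2) by simp
      qed
      then show "\<exists>M. \<forall>m\<ge>M. \<forall>n\<ge>M. norm (\<tau> m - \<tau> n) < e" by blast
    qed
    then obtain t where "\<tau> \<longlonglongrightarrow> t" using Cauchy_convergent convergent_def by blast
    then have "(\<lambda>n. (\<sigma> n, \<tau> n)) \<longlonglongrightarrow> (s, t)" using \<sigma>(2) by (intro tendsto_Pair)
    then show ?thesis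
      unfolding G_def closure_sequential using \<tau>
      by (intro exI[of _ t] exI[of _ "\<lambda>n. (\<sigma> n, \<tau> n)"]) auto
  qed
  define S where "S s = (SOME t. (s, t) \<in> G)" for s
  have S: "(s, S s) \<in> G" for s unfolding S_def using total by (rule someI_ex)
  have S_eq: "S s = t" if "(s, t) \<in> G" for s t using uniq[OF S that] .
  have S_add: "S (s + s') = S s + S s'" for s s'
    using add_G[OF S[of s] S[of s']] by (intro S_eq) simp
  have S_scale: "S (scaleC c s) = scaleC c (S s)" for c s
    by (intro S_eq scale_G S)
  have "bounded_linear S"
    by (rule bounded_linear_intro[of _ C])
       (auto simp: S_add scaleR_scaleC S_scale mult.commute intro: bound_G[OF S])
  then have app: "blinfun_apply (Blinfun S) = S" by (rule bounded_linear_Blinfun_apply)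
  show ?thesis
    by (rule bexI[of _ "Blinfun S"]) (auto simp: app S_scale bounded_ops_def intro: S_eq R_G)
qed

locale tensor_product =
  fixes tens :: "'h::chilbert_space \<Rightarrow> 'e::chilbert_space \<Rightarrow> 'k::chilbert_space"
  assumes hilbert_tensor: "hilbert_tensor tens"
begin

lemma
  shows tens_add_left: "tens (x + x') y = tens x y + tens x' y"
    and tens_add_right: "tens x (y + y') = tens x y + tens x y'"
    and tens_scaleC_left: "tens (scaleC c x) y = scaleC c (tens x y)"
    and tens_scaleC_right: "tens x (scaleC c y) = scaleC c (tens x y)"
    and cinner_tens: "cinner (tens x y) (tens x' y') = cinner x x' * cinner y y'"
    and tens_dense: "closure (cspan {tens x y |x y. True}) = UNIV"
  using hilbert_tensor by (auto simp: hilbert_tensor_def)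

lemma norm_tens: "norm (tens x y) = norm x * norm y"
proof -
  have "complex_of_real ((norm (tens x y))\<^sup>2) = of_real ((norm x * norm y)\<^sup>2)"
    using cinner_tens[of x y x y] by (simp add: cinner_self power_mult_distrib)
  then show ?thesis unfolding of_real_eq_iff by simp
qed

lemma bounded_bilinear_tens: "bounded_bilinear tens"
  by standard
    (auto simp: tens_add_left tens_add_right scaleR_scaleC tens_scaleC_left tens_scaleC_right
      norm_tens intro!: exI[of _ 1])

sublocale tens: bounded_bilinear tens
  by (rule bounded_bilinear_tens)

lemma swapped: "tensor_product (\<lambda>y x. tens x y)"
proof -
  have "{tens y x |x y. True} = {tens x y |x y. True}" by auto
  then have "closure (cspan {tens y x |x y. True}) = UNIV" by (simp only: tens_dense)
  then show ?thesis
    by unfold_locales (simp add: hilbert_tensor_def tens_add_left tens_add_right tens_scaleC_left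
        tens_scaleC_right cinner_tens mult.commute)
qed

text \<open>The expansion is claimed for all large enough finite sets of right factors, so that
  several vectors can be expanded over a common one.\<close>

lemma span_tens_expansion:
  assumes "z \<in> cspan {tens x y |x y. True}"
  obtains U where "finite U" "\<And>V. finite V \<Longrightarrow> U \<subseteq> V \<Longrightarrow> \<exists>\<eta>. z = (\<Sum>u\<in>V. tens (\<eta> u) u)"
proof -
  have "\<exists>U. finite U \<and> (\<forall>V. finite V \<and> U \<subseteq> V \<longrightarrow> (\<exists>\<eta>. z = (\<Sum>u\<in>V. tens (\<eta> u) u)))"
    using assms
  proof (induction rule: complex_vector.span_induct_alt)
    case base
    show ?case by (intro exI[of _ "{}"]) (auto simp: tens.zero_left intro!: exI[of _ "\<lambda>_. 0"])
  next
    case (step c w z)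
    then obtain x y where w: "w = tens x y" by auto
    obtain U where U: "finite U" "\<And>V. finite V \<Longrightarrow> U \<subseteq> V \<Longrightarrow> \<exists>\<eta>. z = (\<Sum>u\<in>V. tens (\<eta> u) u)"
      using step.IH by blast
    have "\<exists>\<eta>. scaleC c w + z = (\<Sum>u\<in>V. tens (\<eta> u) u)" if V: "finite V" "insert y U \<subseteq> V" for V
    proof -
      obtain \<eta> where \<eta>: "z = (\<Sum>u\<in>V. tens (\<eta> u) u)" using U(2) V by blast
      have "(\<Sum>u\<in>V. tens ((if u = y then scaleC c x else 0) + \<eta> u) u)
          = (\<Sum>u\<in>V. if u = y then scaleC c w else 0) + z"
        unfolding \<eta> sum.distrib[symmetric] w
        by (intro sum.cong refl) (simp add: tens_add_left tens_scaleC_left tens.zero_left)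
      also have "\<dots> = scaleC c w + z" using V by simp
      finally show ?thesis by metis
    qed
    then show ?case using U(1) by (intro exI[of _ "insert y U"]) auto
  qed
  then show ?thesis using that by blast
qed

lemma norm_sum_tens_orthonormal:
  assumes "orthonormal U"
  shows "(norm (\<Sum>u\<in>U. tens (\<eta> u) u))\<^sup>2 = (\<Sum>u\<in>U. (norm (\<eta> u))\<^sup>2)"
proof -
  have "cinner (\<Sum>u\<in>U. tens (\<eta> u) u) (\<Sum>u\<in>U. tens (\<eta> u) u)
      = (\<Sum>u\<in>U. \<Sum>v\<in>U. if v = u then cinner (\<eta> u) (\<eta> u) else 0)"
    unfolding cinner.sum_left unfolding cinner.sum_right
    by (intro sum.cong refl) (auto simp: cinner_tens orthonormal_onD(2)[OF assms])
  also have "\<dots> = (\<Sum>u\<in>U. cinner (\<eta> u) (\<eta> u))"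
    using orthonormal_onD(1)[OF assms] by simp
  finally show ?thesis by (simp flip: Re_cinner_self)
qed

lemma sum_tens_orthonormal:
  assumes "\<And>x y. (x, y) \<in> set L \<Longrightarrow> expands_in U y"
  shows "(\<Sum>(x, y)\<leftarrow>L. tens (f x) y) = (\<Sum>u\<in>U. tens (\<Sum>(x, y)\<leftarrow>L. scaleC (cinner y u) (f x)) u)"
  using assms
proof (induction L)
  case Nil
  then show ?case by (simp add: tens.zero_left)
next
  case (Cons p L)
  obtain x y where p: "p = (x, y)" by force
  have "tens (f x) y = (\<Sum>u\<in>U. tens (scaleC (cinner y u) (f x)) u)"
    using Cons.prems[of x y] p
    by (subst expands_in_def[THEN iffD1, of U y]) (auto simp: tens.sum_right tens_scaleC_left tens_scaleC_right)
  moreover have "(\<Sum>(x, y)\<leftarrow>L. tens (f x) y) = (\<Sum>u\<in>U. tens (\<Sum>(x, y)\<leftarrow>L. scaleC (cinner y u) (f x)) u)"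
    by (rule Cons.IH) (use Cons.prems in auto)
  ultimately show ?case by (simp add: p tens_add_left sum.distrib)
qed

text \<open>The bound \<open>\<parallel>T \<otimes> I\<parallel> \<le> \<parallel>T\<parallel>\<close> on sums of elementary tensors.  Expanding the right factors
  in an orthonormal basis \<open>U\<close> turns the sum into \<open>\<Sum>\<^sub>u \<eta>\<^sub>u \<otimes> u\<close>, of squared norm \<open>\<Sum>\<^sub>u \<parallel>\<eta>\<^sub>u\<parallel>\<^sup>2\<close>, and \<open>T \<otimes> I\<close>
  acts on it by \<open>\<eta>\<^sub>u \<mapsto> T \<eta>\<^sub>u\<close>.\<close>

lemma norm_sum_tens_le:
  assumes T: "T \<in> bounded_ops"
  shows "norm (\<Sum>(x, y)\<leftarrow>L. tens (blinfun_apply T x) y) \<le> norm T * norm (\<Sum>(x, y)\<leftarrow>L. tens x y)"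
proof -
  obtain U where U: "orthonormal U" "\<And>y. y \<in> snd ` set L \<Longrightarrow> expands_in U y"
    using finite_orthonormal_basis[of "snd ` set L"] by auto
  have exp: "expands_in U y" if "(x, y) \<in> set L" for x y using U(2) that by force
  define \<eta> where "\<eta> u = (\<Sum>(x, y)\<leftarrow>L. scaleC (cinner y u) x)" for u
  have T\<eta>: "(\<Sum>(x, y)\<leftarrow>L. scaleC (cinner y u) (blinfun_apply T x)) = blinfun_apply T (\<eta> u)" for u
    unfolding \<eta>_def by (induction L) (auto simp: blinfun.add_right bounded_opsD[OF T] blinfun.zero_right)
  have "(norm (\<Sum>(x, y)\<leftarrow>L. tens (blinfun_apply T x) y))\<^sup>2 = (\<Sum>u\<in>U. (norm (blinfun_apply T (\<eta> u)))\<^sup>2)"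
    by (simp add: sum_tens_orthonormal[OF exp] T\<eta> norm_sum_tens_orthonormal[OF U(1)])
  also have "\<dots> \<le> (\<Sum>u\<in>U. (norm T * norm (\<eta> u))\<^sup>2)"
    by (intro sum_mono power_mono norm_blinfun) auto
  also have "\<dots> = (norm T)\<^sup>2 * (\<Sum>u\<in>U. (norm (\<eta> u))\<^sup>2)"
    by (simp add: power_mult_distrib sum_distrib_left)
  also have "\<dots> = (norm T * norm (\<Sum>(x, y)\<leftarrow>L. tens x y))\<^sup>2"
    using sum_tens_orthonormal[where f = "\<lambda>x. x", OF exp] norm_sum_tens_orthonormal[OF U(1), of \<eta>]
    by (simp add: \<eta>_def power_mult_distrib)
  finally show ?thesis by (rule power2_le_imp_le) simp
qed

lemma exists_tens_id:
  assumes T: "T \<in> bounded_ops"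
  obtains S where "S \<in> bounded_ops" "\<And>x y. blinfun_apply S (tens x y) = tens (blinfun_apply T x) y"
proof -
  define s where "s L = (\<Sum>(x, y)\<leftarrow>L. tens x y)" for L
  define t where "t L = (\<Sum>(x, y)\<leftarrow>L. tens (blinfun_apply T x) y)" for L
  define R where "R = range (\<lambda>L. (s L, t L))"
  have scale: "scaleC c (s L) = s (map (\<lambda>(x, y). (scaleC c x, y)) L)"
    "scaleC c (t L) = t (map (\<lambda>(x, y). (scaleC c x, y)) L)" for c L
    by (induction L) (auto simp: s_def t_def scaleC_add_right tens_scaleC_left bounded_opsD[OF T] scaleC.zero_right)
  have app: "s L + s L' = s (L @ L')" "t L + t L' = t (L @ L')" for L L'
    by (simp_all add: s_def t_def)
  have "\<exists>S\<in>bounded_ops. \<forall>a b. (a, b) \<in> R \<longrightarrow> blinfun_apply S a = b"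
  proof (rule extend_bounded_relation[of R "norm T"])
    show "p + q \<in> R" if "p \<in> R" "q \<in> R" for p q
      using that by (auto simp: R_def app)
    show "(scaleC c a, scaleC c b) \<in> R" if "(a, b) \<in> R" for c a b
      using that by (auto simp: R_def scale)
    show "norm b \<le> norm T * norm a" if "(a, b) \<in> R" for a b
      using that norm_sum_tens_le[OF T] by (auto simp: R_def s_def t_def)
    have "z \<in> fst ` R" if "z \<in> cspan {tens x y |x y. True}" for z
    proof -
      have "z \<in> range s" using that
      proof (induction rule: complex_vector.span_induct_alt)
        case base
        show ?case by (intro range_eqI[of _ _ "[]"]) (simp add: s_def)
      next
        case (step c w z)
        then obtain x y L where "w = tens x y" "z = s L" by auto
        then show ?case
          by (intro range_eqI[of _ _ "(scaleC c x, y) # L"]) (simp add: s_def tens_scaleC_left)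
      qed
      then show ?thesis by (auto simp: R_def image_image)
    qed
    then have "closure (cspan {tens x y |x y. True}) \<subseteq> closure (fst ` R)"
      by (intro closure_mono) auto
    then show "closure (fst ` R) = UNIV" using tens_dense by auto
  qed
  then obtain S where S: "S \<in> bounded_ops" "\<And>a b. (a, b) \<in> R \<Longrightarrow> blinfun_apply S a = b"
    by blast
  have "blinfun_apply S (tens x y) = tens (blinfun_apply T x) y" for x y
    by (intro S(2)) (auto simp: R_def s_def t_def intro!: range_eqI[of _ _ "[(x, y)]"])
  then show ?thesis using that S(1) by blast
qed

lemma bounded_ops_eqI:
  fixes S S' :: "'k \<Rightarrow>\<^sub>L 'k"
  assumes S: "S \<in> bounded_ops" "S' \<in> bounded_ops"
    and eq: "\<And>x y. blinfun_apply S (tens x y) = blinfun_apply S' (tens x y)"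
  shows "S = S'"
proof (rule blinfun_eqI)
  fix z
  have "closed {z. blinfun_apply S z = blinfun_apply S' z}"
    by (intro closed_Collect_eq linear_continuous_on blinfun.bounded_linear_right)
  moreover have "cspan {tens x y |x y. True} \<subseteq> {z. blinfun_apply S z = blinfun_apply S' z}"
  proof
    fix z assume "z \<in> cspan {tens x y |x y. True}"
    then show "z \<in> {z. blinfun_apply S z = blinfun_apply S' z}"
    proof (induction rule: complex_vector.span_induct_alt)
      case (step c w z)
      then show ?case
        using eq by (auto simp: blinfun.add_right bounded_opsD[OF S(1)] bounded_opsD[OF S(2)])
    qed (simp add: blinfun.zero_right)
  qed
  ultimately have "closure (cspan {tens x y |x y. True}) \<subseteq> {z. blinfun_apply S z = blinfun_apply S' z}"
    by (rule closure_minimal[rotated])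
  then show "blinfun_apply S z = blinfun_apply S' z" using tens_dense by auto
qed

text \<open>\<open>T \<otimes> A = (T \<otimes> I)(I \<otimes> A)\<close>, where the second factor is obtained from the first kind by exchanging
  the roles of the two spaces.\<close>

lemma
  assumes T: "T \<in> bounded_ops" and A: "A \<in> bounded_ops"
  shows op_tensor_bounded_ops: "op_tensor tens T A \<in> bounded_ops"
    and op_tensor_apply: "blinfun_apply (op_tensor tens T A) (tens x y)
      = tens (blinfun_apply T x) (blinfun_apply A y)"
proof -
  interpret swap: tensor_product "\<lambda>y x. tens x y" by (rule swapped)
  obtain S where S: "S \<in> bounded_ops" "\<And>x y. blinfun_apply S (tens x y) = tens (blinfun_apply T x) y"
    using exists_tens_id[OF T] by metis
  obtain S' where S': "S' \<in> bounded_ops" "\<And>x y. blinfun_apply S' (tens x y) = tens x (blinfun_apply A y)"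
    using swap.exists_tens_id[OF A] by metis
  have *: "S o\<^sub>L S' \<in> bounded_ops \<and>
      (\<forall>x y. blinfun_apply (S o\<^sub>L S') (tens x y) = tens (blinfun_apply T x) (blinfun_apply A y))"
    using S S' by (simp add: compose_bounded_ops)
  have "op_tensor tens T A = S o\<^sub>L S'"
    unfolding op_tensor_def
    by (rule the_equality) (use * in \<open>auto intro!: bounded_ops_eqI\<close>)
  then show "op_tensor tens T A \<in> bounded_ops"
    "blinfun_apply (op_tensor tens T A) (tens x y) = tens (blinfun_apply T x) (blinfun_apply A y)"
    using * by auto
qed

lemma op_tensor_compose:
  assumes "T \<in> bounded_ops" "A \<in> bounded_ops" "T' \<in> bounded_ops" "A' \<in> bounded_ops"
  shows "op_tensor tens T A o\<^sub>L op_tensor tens T' A' = op_tensor tens (T o\<^sub>L T') (A o\<^sub>L A')"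
  using assms by (intro bounded_ops_eqI) (auto simp: compose_bounded_ops op_tensor_bounded_ops op_tensor_apply)

lemma op_tensor_id: "op_tensor tens id_blinfun id_blinfun = id_blinfun"
  by (intro bounded_ops_eqI) (auto simp: id_bounded_ops op_tensor_bounded_ops op_tensor_apply)

lemma op_tensor_add_right:
  assumes "T \<in> bounded_ops" "A \<in> bounded_ops" "A' \<in> bounded_ops"
  shows "op_tensor tens T (A + A') = op_tensor tens T A + op_tensor tens T A'"
  using assms by (intro bounded_ops_eqI)
    (auto simp: add_bounded_ops op_tensor_bounded_ops op_tensor_apply blinfun.add_left tens_add_right)

lemma op_tensor_scaleC:
  assumes "T \<in> bounded_ops" "A \<in> bounded_ops"
  shows "op_tensor tens (op_scaleC c T) A = op_scaleC c (op_tensor tens T A)"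
    and "op_tensor tens T (op_scaleC c A) = op_scaleC c (op_tensor tens T A)"
  using assms by (auto intro!: bounded_ops_eqI simp: op_scaleC_bounded_ops op_tensor_bounded_ops
      op_tensor_apply op_scaleC.rep_eq tens_scaleC_left tens_scaleC_right)

lemma op_tensor_zero_right: "T \<in> bounded_ops \<Longrightarrow> op_tensor tens T 0 = 0"
  by (intro bounded_ops_eqI) (auto simp: zero_bounded_ops op_tensor_bounded_ops op_tensor_apply tens.zero_right)

lemma op_tensor_sum_right:
  assumes "T \<in> bounded_ops" "\<And>i. i \<in> I \<Longrightarrow> A i \<in> bounded_ops"
  shows "op_tensor tens T (\<Sum>i\<in>I. A i) = (\<Sum>i\<in>I. op_tensor tens T (A i))"
  using assms(2)
  by (induction I rule: infinite_finite_induct)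
     (auto simp: op_tensor_zero_right op_tensor_add_right sum_bounded_ops assms(1))

end


section \<open>Scalar functions with nonnegative real part\<close>

lemma sum_roots_unity_powers:
  fixes M :: nat
  defines "\<omega> \<equiv> \<lambda>t. cis (2 * pi * real t / real M)"
  assumes "a < M" "b < M"
  shows "(\<Sum>t<M. \<omega> t ^ a * cnj (\<omega> t) ^ b) = (if a = b then of_nat M else 0)"
proof -
  define z where "z = \<omega> a * cnj (\<omega> b)"
  have M: "M > 0" using assms by simp
  have pow: "\<omega> t ^ a * cnj (\<omega> t) ^ b = z ^ t" for t
    unfolding z_def \<omega>_def cis_cnj Complex.DeMoivre cis_mult
    by (intro arg_cong[of _ _ cis]) (simp add: field_simps)
  have "\<omega> t ^ M = 1" if "t < M" for t
    using bij_betwE[OF Complex.bij_betw_roots_unity[OF M]] that by (simp add: \<omega>_def)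
  then have zM: "z ^ M = 1" using assms by (simp add: z_def power_mult_distrib flip: complex_cnj_power)
  have unit: "\<omega> t * cnj (\<omega> t) = 1" for t by (simp add: \<omega>_def cis_cnj cis_mult)
  have inj: "inj_on \<omega> {..<M}" using Complex.bij_betw_roots_unity[OF M] by (simp add: bij_betw_def \<omega>_def)
  have sum_eq: "(\<Sum>t<M. \<omega> t ^ a * cnj (\<omega> t) ^ b) = (\<Sum>t<M. z ^ t)" by (simp only: pow)
  show ?thesis
  proof (cases "a = b")
    case True
    then have "z = 1" using unit by (simp add: z_def)
    then show ?thesis using sum_eq True by simp
  next
    case False
    have "z \<noteq> 1"
    proof
      assume "z = 1"
      then have "\<omega> a = \<omega> b"
        using unit[of b] unfolding z_def by (metis mult.assoc mult.commute mult_1)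
      then show False using inj assms False by (auto simp: inj_on_def)
    qed
    then have "(\<Sum>t<M. z ^ t) = 0" using zM by (simp add: geometric_sum)
    then show ?thesis using sum_eq False by simp
  qed
qed

text \<open>The positive kernel is \<open>|S(z)|\<^sup>2\<close> with \<open>S(z) = \<Sum>\<^bsub>l<N\<^esub> z\<^sup>l\<close>: averaging \<open>Re f |S|\<^sup>2\<close> over the circle
  leaves the factor \<open>N - k\<close> on the \<open>k\<close>-th coefficient, the number of pairs \<open>l, l' < N\<close> with
  \<open>k + l = l'\<close>.  For a polynomial the average over the circle can be taken over roots of unity, of an
  order so large that distinct exponents \<open>k + l\<close> and \<open>l'\<close> stay distinct modulo it.\<close>

lemma fejer_polynomial:
  assumes pos: "\<And>z. cmod z = 1 \<Longrightarrow> 0 \<le> Re (\<Sum>k<D. a k * z ^ k)"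
  shows "0 \<le> (\<Sum>k<D. real (N - k) * Re (a k))"
proof (cases "D + N = 0")
  case False
  define M where "M = D + N"
  have M: "M > 0" using False by (simp add: M_def)
  define \<omega> where "\<omega> t = cis (2 * pi * real t / real M)" for t
  define S where "S z = (\<Sum>l<N. z ^ l :: complex)" for z
  have count: "(\<Sum>l<N. \<Sum>l'<N. if k + l = l' then of_nat M else 0 :: complex) = of_nat M * of_nat (N - k)" for k
  proof -
    have "(\<Sum>l<N. \<Sum>l'<N. if k + l = l' then of_nat M else 0 :: complex)
        = (\<Sum>l<N. if l < N - k then of_nat M else 0)"
      by (intro sum.cong refl) auto
    also have "\<dots> = (\<Sum>l\<in>{..<N - k}. of_nat M)"
      by (rule sum.mono_neutral_cong_right) auto
    finally show ?thesis by simp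
  qed
  have S_sq: "S z * cnj (S z) = (\<Sum>l<N. \<Sum>l'<N. z ^ l * cnj z ^ l')" for z
    by (simp add: S_def cnj_sum sum_product)
  have "(\<Sum>t<M. (\<Sum>k<D. a k * \<omega> t ^ k) * (S (\<omega> t) * cnj (S (\<omega> t))))
      = (\<Sum>t<M. \<Sum>k<D. \<Sum>l<N. \<Sum>l'<N. a k * (\<omega> t ^ (k + l) * cnj (\<omega> t) ^ l'))"
    unfolding S_sq by (subst sum_distrib_right) (simp only: sum_distrib_left power_add mult.assoc)
  also have "\<dots> = (\<Sum>k<D. \<Sum>l<N. \<Sum>l'<N. a k * (\<Sum>t<M. \<omega> t ^ (k + l) * cnj (\<omega> t) ^ l'))"
    unfolding sum_distrib_left
    by (rule trans[OF sum.swap], rule sum.cong[OF refl], rule trans[OF sum.swap],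
        rule sum.cong[OF refl], rule sum.swap)
  also have "\<dots> = (\<Sum>k<D. \<Sum>l<N. \<Sum>l'<N. a k * (if k + l = l' then of_nat M else 0))"
    unfolding \<omega>_def by (intro sum.cong refl arg_cong2[of _ _ _ _ "(*)"] sum_roots_unity_powers) (auto simp: M_def)
  also have "\<dots> = (\<Sum>k<D. a k * (of_nat M * of_nat (N - k)))"
    by (simp only: sum_distrib_left[symmetric] count)
  also have "Re \<dots> = real M * (\<Sum>k<D. real (N - k) * Re (a k))"
    by (simp add: sum_distrib_left mult_ac)
  finally have "Re (\<Sum>t<M. (\<Sum>k<D. a k * \<omega> t ^ k) * (S (\<omega> t) * cnj (S (\<omega> t))))
      = real M * (\<Sum>k<D. real (N - k) * Re (a k))" .
  moreover have "0 \<le> Re (\<Sum>t<M. (\<Sum>k<D. a k * \<omega> t ^ k) * (S (\<omega> t) * cnj (S (\<omega> t))))"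
    unfolding Re_sum
  proof (intro sum_nonneg)
    fix t
    have "Re ((\<Sum>k<D. a k * \<omega> t ^ k) * (S (\<omega> t) * cnj (S (\<omega> t))))
        = Re (\<Sum>k<D. a k * \<omega> t ^ k) * (cmod (S (\<omega> t)))\<^sup>2"
      by (simp only: complex_norm_square[symmetric] Re_complex_of_real times_complex.sel
          Im_complex_of_real)
    then show "0 \<le> Re ((\<Sum>k<D. a k * \<omega> t ^ k) * (S (\<omega> t) * cnj (S (\<omega> t))))"
      using pos[of "\<omega> t"] by (simp add: \<omega>_def)
  qed
  ultimately show ?thesis using M by (simp add: zero_le_mult_iff)
qed auto

text \<open>Truncate at \<open>D\<close> and add the tail \<open>\<epsilon>\<^sub>D = \<Sum>\<^bsub>k\<ge>D\<^esub> |a\<^sub>k|\<close> to the constant term, which keeps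
  the real part nonnegative; then let \<open>D \<rightarrow> \<infinity>\<close>.\<close>

lemma fejer_power_series:
  assumes sm: "summable (\<lambda>k. cmod (a k))"
    and pos: "\<And>z. cmod z = 1 \<Longrightarrow> 0 \<le> Re (\<Sum>k. a k * z ^ k)"
  shows "0 \<le> (\<Sum>k<N. real (N - k) * Re (a k))"
proof -
  define \<epsilon> where "\<epsilon> D = (\<Sum>k. cmod (a k)) - (\<Sum>k<D. cmod (a k))" for D
  have eps: "\<epsilon> \<longlonglongrightarrow> 0"
    unfolding \<epsilon>_def[abs_def] using tendsto_diff[OF tendsto_const summable_LIMSEQ[OF sm], of "\<Sum>k. cmod (a k)"] by simp
  have ge: "0 \<le> (\<Sum>k<N. real (N - k) * Re (a k)) + real N * \<epsilon> D" if D: "D > N" for D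
  proof -
    define b where "b = a(0 := a 0 + of_real (\<epsilon> D))"
    have "0 \<le> Re (\<Sum>k<D. b k * z ^ k)" if z: "cmod z = 1" for z
    proof -
      have smz: "summable (\<lambda>k. cmod (a k * z ^ k))" using sm z by (simp add: norm_mult norm_power)
      have "(\<Sum>k<D. b k * z ^ k) = (\<Sum>k<D. a k * z ^ k + (if k = 0 then of_real (\<epsilon> D) else 0))"
        by (intro sum.cong refl) (auto simp: b_def)
      also have "\<dots> = (\<Sum>k<D. a k * z ^ k) + of_real (\<epsilon> D)" using D by (simp add: sum.distrib)
      finally have b_eq: "Re (\<Sum>k<D. b k * z ^ k) = Re (\<Sum>k<D. a k * z ^ k) + \<epsilon> D" by simp
      have tail: "(\<Sum>k. a k * z ^ k) = (\<Sum>k. a (k + D) * z ^ (k + D)) + (\<Sum>k<D. a k * z ^ k)"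
        by (rule suminf_split_initial_segment) (rule summable_norm_cancel[OF smz])
      have "Re (\<Sum>k. a (k + D) * z ^ (k + D)) \<le> cmod (\<Sum>k. a (k + D) * z ^ (k + D))"
        by (rule complex_Re_le_cmod)
      also have "\<dots> \<le> (\<Sum>k. cmod (a (k + D) * z ^ (k + D)))"
        using smz by (intro summable_norm) (subst summable_iff_shift[of "\<lambda>k. cmod (a k * z ^ k)"])
      also have "\<dots> = \<epsilon> D"
        unfolding \<epsilon>_def using z by (simp add: norm_mult norm_power suminf_minus_initial_segment[OF sm])
      finally show ?thesis using pos[OF z] b_eq tail by simp
    qed
    then have "0 \<le> (\<Sum>k<D. real (N - k) * Re (b k))" by (rule fejer_polynomial)
    also have "\<dots> = (\<Sum>k<D. real (N - k) * Re (a k) + (if k = 0 then real N * \<epsilon> D else 0))"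
      by (intro sum.cong refl) (auto simp: b_def algebra_simps)
    also have "\<dots> = (\<Sum>k<D. real (N - k) * Re (a k)) + real N * \<epsilon> D" using D by (simp add: sum.distrib)
    also have "(\<Sum>k<D. real (N - k) * Re (a k)) = (\<Sum>k<N. real (N - k) * Re (a k))"
      using D by (intro sum.mono_neutral_right) auto
    finally show ?thesis .
  qed
  have "(\<lambda>D. (\<Sum>k<N. real (N - k) * Re (a k)) + real N * \<epsilon> D) \<longlonglongrightarrow> (\<Sum>k<N. real (N - k) * Re (a k)) + real N * 0"
    by (intro tendsto_intros eps)
  then show ?thesis
    using ge by (intro LIMSEQ_le_const[where X = "\<lambda>D. (\<Sum>k<N. real (N - k) * Re (a k)) + real N * \<epsilon> D"])
      (auto intro!: exI[of _ "Suc N"])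
qed

text \<open>The Cayley transform \<open>(u - w) / (u + cnj w)\<close> with \<open>w = f(0)\<close> maps the right half plane to the
  disc, so that Schwarz's lemma gives \<open>|f(\<zeta>) - w| \<le> |\<zeta>| |f(\<zeta>) + cnj w|\<close>; both inequalities follow by
  discarding the imaginary parts.  Replacing \<open>f\<close> by \<open>f + \<epsilon>\<close> makes the real parts strictly positive.\<close>

lemma harnack_disc:
  fixes f :: "complex \<Rightarrow> complex"
  assumes hol: "f holomorphic_on ball 0 1"
    and pos: "\<And>z. cmod z < 1 \<Longrightarrow> 0 \<le> Re (f z)" and \<zeta>: "cmod \<zeta> < 1"
  shows "(1 - cmod \<zeta>) * Re (f \<zeta>) \<le> (1 + cmod \<zeta>) * Re (f 0)"
    and "(1 - cmod \<zeta>) * Re (f 0) \<le> (1 + cmod \<zeta>) * Re (f \<zeta>)"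
proof -
  define r where "r = cmod \<zeta>"
  have r: "0 \<le> r" "r < 1" using \<zeta> by (auto simp: r_def)
  have main: "(1 - r) * (Re (f \<zeta>) + \<epsilon>) \<le> (1 + r) * (Re (f 0) + \<epsilon>) \<and>
      (1 - r) * (Re (f 0) + \<epsilon>) \<le> (1 + r) * (Re (f \<zeta>) + \<epsilon>)" if \<epsilon>: "\<epsilon> > 0" for \<epsilon> :: real
  proof -
    define w where "w = f 0 + of_real \<epsilon>"
    define g where "g z = (f z + of_real \<epsilon> - w) / (f z + of_real \<epsilon> + cnj w)" for z
    have Rew: "Re w > 0" using pos[of 0] \<epsilon> by (simp add: w_def add_nonneg_pos)
    have Refz: "Re (f z + of_real \<epsilon>) > 0" if "cmod z < 1" for z using pos[OF that] \<epsilon> by simp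
    have cayley: "cmod (u - w) < cmod (u + cnj w)" if "Re u > 0" for u
    proof -
      have "(cmod (u + cnj w))\<^sup>2 - (cmod (u - w))\<^sup>2 = 4 * (Re u * Re w)"
        unfolding cmod_power2 by (simp add: power2_eq_square algebra_simps)
      then have "(cmod (u - w))\<^sup>2 < (cmod (u + cnj w))\<^sup>2" using mult_pos_pos[OF that Rew] by linarith
      then show ?thesis by (rule power2_less_imp_less) simp
    qed
    have "cmod (g \<zeta>) \<le> cmod \<zeta>"
    proof (rule Schwarz_Lemma(1)[OF _ _ _ \<zeta>])
      show "g holomorphic_on ball 0 1"
        unfolding g_def
      proof (intro holomorphic_intros hol)
        fix z :: complex assume "z \<in> ball 0 1"
        then have "Re (f z + of_real \<epsilon> + cnj w) > 0" using Refz[of z] Rew by simp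
        then show "f z + of_real \<epsilon> + cnj w \<noteq> 0" by (metis less_irrefl zero_complex.sel(1))
      qed
      show "g 0 = 0" by (simp add: g_def w_def)
      show "cmod (g z) < 1" if "cmod z < 1" for z
        using cayley[OF Refz[OF that]] by (simp add: g_def norm_divide divide_less_eq)
    qed
    moreover have "cmod (f \<zeta> + of_real \<epsilon> + cnj w) > 0"
      using cayley[OF Refz[OF \<zeta>]] norm_ge_zero order_le_less_trans by blast
    ultimately have le: "cmod (f \<zeta> + of_real \<epsilon> - w) \<le> r * cmod (f \<zeta> + of_real \<epsilon> + cnj w)"
      by (simp add: g_def norm_divide divide_le_eq r_def)
    define x y c where "x = Re (f \<zeta>) + \<epsilon>" and "y = Im (f \<zeta>) - Im w" and "c = Re w"
    have "(cmod (f \<zeta> + of_real \<epsilon> - w))\<^sup>2 \<le> (r * cmod (f \<zeta> + of_real \<epsilon> + cnj w))\<^sup>2"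
      using le by (intro power_mono) auto
    then have "(x - c)\<^sup>2 + y\<^sup>2 \<le> r\<^sup>2 * ((x + c)\<^sup>2 + y\<^sup>2)"
      by (simp add: cmod_power2 power_mult_distrib x_def y_def c_def)
    moreover have "r\<^sup>2 * y\<^sup>2 \<le> 1 * y\<^sup>2" using r by (intro mult_right_mono) (auto simp: power_le_one)
    ultimately have "(x - c)\<^sup>2 \<le> r\<^sup>2 * (x + c)\<^sup>2" by (simp add: distrib_left)
    then have "(x - c)\<^sup>2 \<le> (r * (x + c))\<^sup>2" unfolding power_mult_distrib .
    moreover have "0 \<le> r * (x + c)" using r Rew Refz[OF \<zeta>] by (simp add: x_def c_def)
    ultimately have "\<bar>x - c\<bar> \<le> r * (x + c)" by (metis abs_le_square_iff abs_of_nonneg)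
    then show ?thesis by (simp add: x_def c_def w_def abs_le_iff algebra_simps)
  qed
  show "(1 - cmod \<zeta>) * Re (f \<zeta>) \<le> (1 + cmod \<zeta>) * Re (f 0)"
  proof (rule field_le_epsilon)
    fix e :: real assume e: "e > 0"
    have re: "r * e \<le> e" using mult_right_mono[of r 1 e] r e by simp
    have expand: "(1 - r) * (t + e / 2) = (1 - r) * t + (e / 2 - r * e / 2)"
      "(1 + r) * (t + e / 2) = (1 + r) * t + (e / 2 + r * e / 2)" for t
      by (simp_all add: field_simps)
    show "(1 - cmod \<zeta>) * Re (f \<zeta>) \<le> (1 + cmod \<zeta>) * Re (f 0) + e"
      using main[of "e / 2"] e re unfolding r_def[symmetric] expand by linarith
  qed
  show "(1 - cmod \<zeta>) * Re (f 0) \<le> (1 + cmod \<zeta>) * Re (f \<zeta>)"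
  proof (rule field_le_epsilon)
    fix e :: real assume e: "e > 0"
    have re: "r * e \<le> e" using mult_right_mono[of r 1 e] r e by simp
    have expand: "(1 - r) * (t + e / 2) = (1 - r) * t + (e / 2 - r * e / 2)"
      "(1 + r) * (t + e / 2) = (1 + r) * t + (e / 2 + r * e / 2)" for t
      by (simp_all add: field_simps)
    show "(1 - cmod \<zeta>) * Re (f 0) \<le> (1 + cmod \<zeta>) * Re (f \<zeta>) + e"
      using main[of "e / 2"] e re unfolding r_def[symmetric] expand by linarith
  qed
qed

lemma tendsto_average:
  fixes u :: "nat \<Rightarrow> 'a::real_normed_vector"
  assumes "u \<longlonglongrightarrow> s"
  shows "(\<lambda>N. (1 / real N) *\<^sub>R (\<Sum>n<N. u n)) \<longlonglongrightarrow> s"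
proof (rule LIMSEQ_I)
  fix e :: real assume e: "e > 0"
  obtain N0 where N0: "\<And>n. n \<ge> N0 \<Longrightarrow> norm (u n - s) < e / 2"
    using LIMSEQ_D[OF assms, of "e / 2"] e by auto
  define K where "K = (\<Sum>n<N0. norm (u n - s))"
  obtain N1 :: nat where N1: "2 * K / e < real N1" using reals_Archimedean2 by blast
  have "norm ((1 / real N) *\<^sub>R (\<Sum>n<N. u n) - s) < e" if N: "N \<ge> max (Suc N0) N1" for N
  proof -
    have N_pos: "real N > 0" using N by simp
    have "(1 / real N) *\<^sub>R (\<Sum>n<N. u n) - s = (1 / real N) *\<^sub>R (\<Sum>n<N. u n - s)"
      using N_pos by (simp add: sum_subtractf scaleR_diff_right sum_constant_scaleR)
    then have "norm ((1 / real N) *\<^sub>R (\<Sum>n<N. u n) - s) \<le> (1 / real N) * (\<Sum>n<N. norm (u n - s))"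
      using N_pos by (simp add: divide_right_mono norm_sum)
    also have "(\<Sum>n<N. norm (u n - s)) = K + (\<Sum>n\<in>{N0..<N}. norm (u n - s))"
      unfolding K_def lessThan_atLeast0 using N by (intro sum.atLeastLessThan_concat[symmetric]) auto
    also have "(\<Sum>n\<in>{N0..<N}. norm (u n - s)) \<le> real N * (e / 2)"
    proof -
      have "(\<Sum>n\<in>{N0..<N}. norm (u n - s)) \<le> (\<Sum>n\<in>{N0..<N}. e / 2)"
        using N0 by (intro sum_mono) (auto intro: less_imp_le)
      also have "\<dots> = real (N - N0) * (e / 2)" by simp
      also have "\<dots> \<le> real N * (e / 2)" using e by (intro mult_right_mono) auto
      finally show ?thesis .
    qed
    finally have le: "norm ((1 / real N) *\<^sub>R (\<Sum>n<N. u n) - s) \<le> (1 / real N) * (K + real N * (e / 2))"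
      using N_pos by (simp add: divide_right_mono)
    have "2 * K / e < real N" using N1 N by linarith
    then have "K < real N * (e / 2)" using e by (simp add: field_simps)
    then have "(1 / real N) * (K + real N * (e / 2)) < (1 / real N) * (real N * e)"
      using N_pos by (intro mult_strict_left_mono) auto
    then show ?thesis using le N_pos by simp
  qed
  then show "\<exists>no. \<forall>n\<ge>no. norm ((1 / real n) *\<^sub>R (\<Sum>k<n. u k) - s) < e" by blast
qed

text \<open>Fejer means are averages of partial sums.\<close>

lemma tendsto_fejer_mean:
  fixes c :: "nat \<Rightarrow> 'a::real_normed_vector"
  assumes "c sums s"
  shows "(\<lambda>N. \<Sum>k<N. (real (N - k) / real N) *\<^sub>R c k) \<longlonglongrightarrow> s"
proof -
  have "(\<lambda>n. \<Sum>k<Suc n. c k) \<longlonglongrightarrow> s"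
    using assms unfolding sums_def by (rule LIMSEQ_Suc)
  then have "(\<lambda>N. (1 / real N) *\<^sub>R (\<Sum>n<N. \<Sum>k<Suc n. c k)) \<longlonglongrightarrow> s" by (rule tendsto_average)
  moreover have "(\<Sum>n<N. \<Sum>k<Suc n. c k) = (\<Sum>k<N. real (N - k) *\<^sub>R c k)" for N
  proof (induction N)
    case (Suc N)
    have "(\<Sum>k<Suc N. real (Suc N - k) *\<^sub>R c k) = (\<Sum>k<Suc N. real (N - k) *\<^sub>R c k + c k)"
      by (intro sum.cong refl) (auto simp: Suc_diff_le scaleR_add_left)
    then show ?case using Suc by (simp add: sum.distrib)
  qed simp
  ultimately show ?thesis by (simp only: scaleR_sum_right scaleR_scaleR times_divide_eq_left mult_1)
qed


section \<open>Harnack equivalence on the open ball\<close>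

text \<open>\<open>\<langle>p(0)\<xi>, \<xi>\<rangle>\<close>: at the zero tuple only the coefficient of the empty word contributes.\<close>

definition poly_form_at_zero :: "nat \<Rightarrow> 'n mat_family \<Rightarrow> (nat \<Rightarrow> 'k::chilbert_space) \<Rightarrow> complex"
  where "poly_form_at_zero q p \<xi> = (\<Sum>i<q. \<Sum>j<q. \<Sum>\<alpha>\<in>poly_support q p.
     if \<alpha> = [] then p \<alpha> i j * cinner (\<xi> j) (\<xi> i) else 0)"

lemma mat_form_poly_eval_scaled:
  assumes "\<And>i. X i \<in> bounded_ops"
  shows "mat_form q (poly_eval q p (\<lambda>i. op_scaleC z (X i))) \<xi> =
    (\<Sum>i<q. \<Sum>j<q. \<Sum>\<alpha>\<in>poly_support q p.
       z ^ length \<alpha> * (p \<alpha> i j * cinner (blinfun_apply (word_op X \<alpha>) (\<xi> j)) (\<xi> i)))"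
  by (simp add: mat_form_poly_eval word_op_scaled[OF assms] op_scaleC.rep_eq cinner_scaleC_left mult_ac)

text \<open>With \<open>RX\<close> in the ball for some \<open>R > 1\<close>, the function \<open>f(z) = \<langle>p(zRX)\<xi>, \<xi>\<rangle>\<close> has nonnegative real
  part on the unit disc, and Harnack's inequality compares \<open>f(1/R)\<close>, the form of \<open>p(X)\<close>, with \<open>f(0)\<close>.
  The constant \<open>(1 + 1/R) / (1 - 1/R)\<close> depends on \<open>X\<close> only.\<close>

lemma harnack_origin:
  fixes X :: "'n::finite \<Rightarrow> 'h::chilbert_space \<Rightarrow>\<^sub>L 'h"
  assumes "X \<in> op_ball"
  obtains K where "K \<ge> 1"
    "\<And>q p \<xi>. poly_Re_nonneg TYPE('h) q p \<Longrightarrow>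
       Re (mat_form q (poly_eval q p X) \<xi>) \<le> K * Re (poly_form_at_zero q p \<xi>) \<and>
       Re (poly_form_at_zero q p \<xi>) \<le> K * Re (mat_form q (poly_eval q p X) \<xi>)"
proof -
  obtain R where R: "R > 1" and ball: "\<And>c. cmod c \<le> R \<Longrightarrow> (\<lambda>i. op_scaleC c (X i)) \<in> op_ball"
    using op_ball_expand[OF assms] by metis
  have X: "\<And>i. X i \<in> bounded_ops" using assms by (simp add: op_ball_def)
  define K where "K = (R + 1) / (R - 1)"
  have K: "K \<ge> 1" using R by (simp add: K_def field_simps)
  have "Re (mat_form q (poly_eval q p X) \<xi>) \<le> K * Re (poly_form_at_zero q p \<xi>) \<and>
       Re (poly_form_at_zero q p \<xi>) \<le> K * Re (mat_form q (poly_eval q p X) \<xi>)"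
    if p: "poly_Re_nonneg TYPE('h) q p" for q p \<xi>
  proof -
    define f where "f z = mat_form q (poly_eval q p (\<lambda>i. op_scaleC (of_real R * z) (X i))) \<xi>" for z
    have hol: "f holomorphic_on ball 0 1"
      unfolding f_def[abs_def] mat_form_poly_eval_scaled[OF X] by (intro holomorphic_intros)
    have pos: "0 \<le> Re (f z)" if "cmod z < 1" for z
    proof -
      have "(\<lambda>i. op_scaleC (of_real R * z) (X i)) \<in> op_ball"
        using R that by (intro ball) (simp add: norm_mult mult_le_cancel_left1)
      then show ?thesis using p unfolding poly_Re_nonneg_iff f_def by blast
    qed
    have f0: "f 0 = poly_form_at_zero q p \<xi>"
      unfolding f_def mat_form_poly_eval_scaled[OF X] poly_form_at_zero_def
      by (intro sum.cong refl) auto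
    have f1: "f (of_real (1 / R)) = mat_form q (poly_eval q p X) \<xi>"
    proof -
      have "op_scaleC (of_real R * of_real (1 / R)) (X i) = X i" for i
        using R by (intro blinfun_eqI) (simp add: op_scaleC.rep_eq scaleC_one)
      then show ?thesis by (simp add: f_def)
    qed
    have n: "cmod (of_real (1 / R)) = 1 / R" using R by (simp only: norm_of_real) simp
    have lt: "cmod (of_real (1 / R)) < 1" unfolding n using R by simp
    note H = harnack_disc[OF hol pos lt, unfolded n f0 f1]
    have scale: "a \<le> K * b" if "(1 - 1 / R) * a \<le> (1 + 1 / R) * b" for a b
    proof -
      have "R * ((1 - 1 / R) * a) \<le> R * ((1 + 1 / R) * b)"
        using R that by (intro mult_left_mono) auto
      moreover have "R * ((1 - 1 / R) * a) = (R - 1) * a" "R * ((1 + 1 / R) * b) = (R + 1) * b"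
        using R by (simp_all add: field_simps)
      ultimately have "(R - 1) * a \<le> (R + 1) * b" by simp
      then show ?thesis using R by (simp add: K_def field_simps)
    qed
    show ?thesis using H by (auto intro: scale)
  qed
  then show ?thesis using that K by blast
qed

lemma op_ball_harnack_dominated:
  fixes X Y :: "'n::finite \<Rightarrow> 'h::chilbert_space \<Rightarrow>\<^sub>L 'h"
  assumes X: "X \<in> op_ball" and Y: "Y \<in> op_ball"
  obtains c where "c \<ge> 1" "harnack_dominated TYPE('h) c X Y"
proof -
  obtain K where K: "K \<ge> 1" "\<And>q p \<xi>. poly_Re_nonneg TYPE('h) q p \<Longrightarrow>
       Re (mat_form q (poly_eval q p X) \<xi>) \<le> K * Re (poly_form_at_zero q p \<xi>) \<and>
       Re (poly_form_at_zero q p \<xi>) \<le> K * Re (mat_form q (poly_eval q p X) \<xi>)"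
    using harnack_origin[OF X] by metis
  obtain L where L: "L \<ge> 1" "\<And>q p \<xi>. poly_Re_nonneg TYPE('h) q p \<Longrightarrow>
       Re (mat_form q (poly_eval q p Y) \<xi>) \<le> L * Re (poly_form_at_zero q p \<xi>) \<and>
       Re (poly_form_at_zero q p \<xi>) \<le> L * Re (mat_form q (poly_eval q p Y) \<xi>)"
    using harnack_origin[OF Y] by metis
  define c where "c = sqrt (K * L)"
  have KL: "K * L \<ge> 1" using K(1) L(1) mult_mono[of 1 K 1 L] by simp
  have c: "c\<^sup>2 = K * L" "c \<ge> 1" using KL by (simp_all add: c_def)
  have "Re (mat_form q (poly_eval q p Y) \<xi>) / c\<^sup>2 \<le> Re (mat_form q (poly_eval q p X) \<xi>) \<and>
      Re (mat_form q (poly_eval q p X) \<xi>) \<le> c\<^sup>2 * Re (mat_form q (poly_eval q p Y) \<xi>)"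
    if p: "poly_Re_nonneg TYPE('h) q p" for q p \<xi>
  proof -
    let ?x = "Re (mat_form q (poly_eval q p X) \<xi>)" and ?y = "Re (mat_form q (poly_eval q p Y) \<xi>)"
      and ?z = "Re (poly_form_at_zero q p \<xi>)"
    have "?x \<le> K * (L * ?y)"
      using K(2)[OF p, of \<xi>] L(2)[OF p, of \<xi>] mult_left_mono[of ?z "L * ?y" K] K(1) by linarith
    moreover have "?y \<le> L * (K * ?x)"
      using K(2)[OF p, of \<xi>] L(2)[OF p, of \<xi>] mult_left_mono[of ?z "K * ?x" L] L(1) by linarith
    ultimately show ?thesis using KL by (simp add: c(1) divide_le_eq mult_ac)
  qed
  then have "harnack_dominated TYPE('h) c X Y"
    using c(2) by (subst harnack_dominated_iff) (auto simp: op_ball_subset_cball X Y)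
  then show ?thesis using that c(2) by blast
qed


section \<open>Polynomials with operator coefficients\<close>

lemma sum_lessThan_mult: "(\<Sum>a<q * r. h a) = (\<Sum>i<q. \<Sum>u<r. h (i * r + u :: nat))"
proof -
  have "(\<Sum>u<r. h (i * r + u)) = sum h {i * r..<i * r + r}" for i
    using sum.shift_bounds_nat_ivl[of h 0 "i * r" r] by (simp add: lessThan_atLeast0 add.commute)
  then show ?thesis by (simp add: sum.nat_group)
qed

context tensor_product
begin

text \<open>The values at tuples outside \<open>bounded_ops\<close> are left open, as \<open>op_tensor\<close> is meaningful for complex
  linear operators only.\<close>

definition op_polynomial :: "(('n \<Rightarrow> 'h \<Rightarrow>\<^sub>L 'h) \<Rightarrow> ('k \<Rightarrow>\<^sub>L 'k)) \<Rightarrow> bool" where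
  "op_polynomial G \<longleftrightarrow> (\<exists>W B. finite W \<and> (\<forall>\<gamma>. B \<gamma> \<in> bounded_ops) \<and>
     (\<forall>X. (\<forall>i. X i \<in> bounded_ops) \<longrightarrow> G X = (\<Sum>\<gamma>\<in>W. op_tensor tens (word_op X \<gamma>) (B \<gamma>))))"

lemma op_polynomial_monom:
  assumes "A \<in> bounded_ops"
  shows "op_polynomial (\<lambda>X. op_tensor tens (word_op X \<gamma>) A)"
  unfolding op_polynomial_def
  by (intro exI[of _ "{\<gamma>}"] exI[of _ "\<lambda>_. A"]) (simp add: assms)

lemma op_polynomial_zero: "op_polynomial (\<lambda>X. 0)"
  unfolding op_polynomial_def by (intro exI[of _ "{}"] exI[of _ "\<lambda>_. 0"]) (simp add: zero_bounded_ops)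

lemma op_polynomial_add:
  assumes "op_polynomial G" "op_polynomial G'"
  shows "op_polynomial (\<lambda>X. G X + G' X)"
proof -
  obtain W B where G: "finite W" "\<And>\<gamma>. B \<gamma> \<in> bounded_ops"
    "\<And>X. (\<forall>i. X i \<in> bounded_ops) \<Longrightarrow> G X = (\<Sum>\<gamma>\<in>W. op_tensor tens (word_op X \<gamma>) (B \<gamma>))"
    using assms(1) unfolding op_polynomial_def by metis
  obtain W' B' where G': "finite W'" "\<And>\<gamma>. B' \<gamma> \<in> bounded_ops"
    "\<And>X. (\<forall>i. X i \<in> bounded_ops) \<Longrightarrow> G' X = (\<Sum>\<gamma>\<in>W'. op_tensor tens (word_op X \<gamma>) (B' \<gamma>))"
    using assms(2) unfolding op_polynomial_def by metis
  define C where "C \<gamma> = (if \<gamma> \<in> W then B \<gamma> else 0)" for \<gamma>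
  define C' where "C' \<gamma> = (if \<gamma> \<in> W' then B' \<gamma> else 0)" for \<gamma>
  have C: "C \<gamma> \<in> bounded_ops" "C' \<gamma> \<in> bounded_ops" for \<gamma>
    by (simp_all add: C_def C'_def G G' zero_bounded_ops)
  have "G X + G' X = (\<Sum>\<gamma>\<in>W \<union> W'. op_tensor tens (word_op X \<gamma>) (C \<gamma> + C' \<gamma>))"
    if X: "\<forall>i. X i \<in> bounded_ops" for X
  proof -
    have w: "word_op X \<gamma> \<in> bounded_ops" for \<gamma> using X by (intro word_op_bounded_ops) auto
    have "G X = (\<Sum>\<gamma>\<in>W \<union> W'. op_tensor tens (word_op X \<gamma>) (C \<gamma>))"
      unfolding G(3)[OF X]
      by (rule sum.mono_neutral_cong_left) (auto simp: G G' C_def op_tensor_zero_right[OF w])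
    moreover have "G' X = (\<Sum>\<gamma>\<in>W \<union> W'. op_tensor tens (word_op X \<gamma>) (C' \<gamma>))"
      unfolding G'(3)[OF X]
      by (rule sum.mono_neutral_cong_left) (auto simp: G G' C'_def op_tensor_zero_right[OF w])
    ultimately show ?thesis by (simp add: op_tensor_add_right w C sum.distrib)
  qed
  then show ?thesis
    unfolding op_polynomial_def using G(1) G'(1) C
    by (intro exI[of _ "W \<union> W'"] exI[of _ "\<lambda>\<gamma>. C \<gamma> + C' \<gamma>"]) (auto intro: add_bounded_ops)
qed

lemma op_polynomial_sum:
  "(\<And>i. i \<in> I \<Longrightarrow> op_polynomial (G i)) \<Longrightarrow> op_polynomial (\<lambda>X. \<Sum>i\<in>I. G i X)"
  by (induction I rule: infinite_finite_induct) (auto intro: op_polynomial_zero op_polynomial_add)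

lemma op_polynomial_scaleC:
  fixes G :: "('n \<Rightarrow> 'h \<Rightarrow>\<^sub>L 'h) \<Rightarrow> ('k \<Rightarrow>\<^sub>L 'k)"
  assumes "op_polynomial G"
  shows "op_polynomial (\<lambda>X. op_scaleC c (G X))"
proof -
  obtain W B where G: "finite W" "\<And>\<gamma>. B \<gamma> \<in> bounded_ops"
    "\<And>X. (\<forall>i. X i \<in> bounded_ops) \<Longrightarrow> G X = (\<Sum>\<gamma>\<in>W. op_tensor tens (word_op X \<gamma>) (B \<gamma>))"
    using assms unfolding op_polynomial_def by metis
  have sum: "op_scaleC c (\<Sum>\<gamma>\<in>W. T \<gamma>) = (\<Sum>\<gamma>\<in>W. op_scaleC c (T \<gamma>))" for T :: "'n list \<Rightarrow> 'k \<Rightarrow>\<^sub>L 'k"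
    by (rule blinfun_eqI) (simp add: op_scaleC.rep_eq blinfun.sum_left scaleC.sum_right)
  show ?thesis
    unfolding op_polynomial_def
    by (intro exI[of _ W] exI[of _ "\<lambda>\<gamma>. op_scaleC c (B \<gamma>)"])
      (auto simp: G sum op_scaleC_bounded_ops op_tensor_scaleC word_op_bounded_ops)
qed

text \<open>The product of \<open>X\<^sub>\<gamma> \<otimes> B\<^sub>\<gamma>\<close> and \<open>X\<^sub>\<delta> \<otimes> B'\<^sub>\<delta>\<close> is \<open>X\<^sub>\<gamma>\<^sub>\<delta> \<otimes> B\<^sub>\<gamma> B'\<^sub>\<delta>\<close>; the coefficient of \<open>\<epsilon>\<close> collects all
  factorisations \<open>\<epsilon> = \<gamma>\<delta>\<close>.\<close>

lemma op_polynomial_compose: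
  assumes "op_polynomial G" "op_polynomial G'"
  shows "op_polynomial (\<lambda>X. G X o\<^sub>L G' X)"
proof -
  obtain W B where G: "finite W" "\<And>\<gamma>. B \<gamma> \<in> bounded_ops"
    "\<And>X. (\<forall>i. X i \<in> bounded_ops) \<Longrightarrow> G X = (\<Sum>\<gamma>\<in>W. op_tensor tens (word_op X \<gamma>) (B \<gamma>))"
    using assms(1) unfolding op_polynomial_def by metis
  obtain W' B' where G': "finite W'" "\<And>\<gamma>. B' \<gamma> \<in> bounded_ops"
    "\<And>X. (\<forall>i. X i \<in> bounded_ops) \<Longrightarrow> G' X = (\<Sum>\<gamma>\<in>W'. op_tensor tens (word_op X \<gamma>) (B' \<gamma>))"
    using assms(2) unfolding op_polynomial_def by metis
  define V where "V \<epsilon> = {w \<in> W \<times> W'. fst w @ snd w = \<epsilon>}" for \<epsilon>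
  define C where "C \<epsilon> = (\<Sum>w\<in>V \<epsilon>. B (fst w) o\<^sub>L B' (snd w))" for \<epsilon>
  have fin: "finite (W \<times> W')" using G G' by simp
  have bC: "B (fst w) o\<^sub>L B' (snd w) \<in> bounded_ops" for w
    by (intro compose_bounded_ops G G')
  have "G X o\<^sub>L G' X = (\<Sum>\<epsilon>\<in>(\<lambda>w. fst w @ snd w) ` (W \<times> W'). op_tensor tens (word_op X \<epsilon>) (C \<epsilon>))"
    if X: "\<forall>i. X i \<in> bounded_ops" for X
  proof -
    have w: "word_op X \<gamma> \<in> bounded_ops" for \<gamma> using X by (intro word_op_bounded_ops) auto
    have "G X o\<^sub>L G' X = (\<Sum>\<gamma>\<in>W. \<Sum>\<delta>\<in>W'.
        op_tensor tens (word_op X \<gamma>) (B \<gamma>) o\<^sub>L op_tensor tens (word_op X \<delta>) (B' \<delta>))"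
      by (simp add: G(3)[OF X] G'(3)[OF X] bounded_bilinear.sum_left[OF bounded_bilinear_blinfun_compose]
          bounded_bilinear.sum_right[OF bounded_bilinear_blinfun_compose]) (rule sum.swap)
    also have "\<dots> = (\<Sum>w\<in>W \<times> W'. op_tensor tens (word_op X (fst w @ snd w)) (B (fst w) o\<^sub>L B' (snd w)))"
      by (simp add: op_tensor_compose w G G' word_op_append sum.cartesian_product split_beta)
    also have "\<dots> = (\<Sum>\<epsilon>\<in>(\<lambda>w. fst w @ snd w) ` (W \<times> W').
        \<Sum>w\<in>V \<epsilon>. op_tensor tens (word_op X (fst w @ snd w)) (B (fst w) o\<^sub>L B' (snd w)))"
      unfolding V_def by (rule sum.image_gen[OF fin])
    also have "\<dots> = (\<Sum>\<epsilon>\<in>(\<lambda>w. fst w @ snd w) ` (W \<times> W'). op_tensor tens (word_op X \<epsilon>) (C \<epsilon>))"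
      unfolding C_def op_tensor_sum_right[OF w bC]
      by (intro sum.cong refl) (simp add: V_def)
    finally show ?thesis .
  qed
  then show ?thesis
    unfolding op_polynomial_def using fin bC
    by (intro exI[of _ "(\<lambda>w. fst w @ snd w) ` (W \<times> W')"] exI[of _ C]) (auto simp: C_def intro: sum_bounded_ops)
qed

lemma op_polynomial_word_op:
  assumes "\<And>j. op_polynomial (G j)"
  shows "op_polynomial (\<lambda>X. word_op (\<lambda>j. G j X) \<beta>)"
proof (induction \<beta>)
  case Nil
  show ?case using op_polynomial_monom[of id_blinfun "[]"] by (simp add: op_tensor_id id_bounded_ops)
next
  case (Cons j \<beta>)
  then show ?case by (simp add: op_polynomial_compose assms)
qed

lemma op_polynomial_poly_eval:
  "(\<And>j. op_polynomial (G j)) \<Longrightarrow> op_polynomial (\<lambda>X. poly_eval q p (\<lambda>j. G j X) a b)"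
  unfolding poly_eval_def by (intro op_polynomial_sum op_polynomial_scaleC op_polynomial_word_op)

text \<open>The form of an operator-valued coefficient \<open>B\<^sub>i\<^sub>j\<close> on vectors \<open>\<Sum>\<^sub>v \<eta>\<^sub>v \<otimes> e\<^sub>v\<close> depends only on the
  scalars \<open>\<langle>B\<^sub>i\<^sub>j e\<^sub>v, e\<^sub>u\<rangle>\<close>.  These are the entries of a matrix of size \<open>q r\<close>, in which the index pair
  \<open>(i, u)\<close> is encoded as \<open>i * r + u\<close>.\<close>

lemma op_polynomial_matrix_compression:
  fixes M :: "nat \<Rightarrow> nat \<Rightarrow> ('n::finite \<Rightarrow> 'h \<Rightarrow>\<^sub>L 'h) \<Rightarrow> ('k \<Rightarrow>\<^sub>L 'k)"
  assumes "\<And>i j. op_polynomial (M i j)"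
  shows "\<exists>P. is_nc_poly (q * r) P \<and> (\<forall>X \<eta>. (\<forall>i. X i \<in> bounded_ops) \<longrightarrow>
     mat_form (q * r) (poly_eval (q * r) P X) \<eta> =
       mat_form q (\<lambda>i j. M i j X) (\<lambda>i. \<Sum>v<r. tens (\<eta> (i * r + v)) (e v)))"
proof -
  obtain W B where M: "\<And>i j. finite (W i j)" "\<And>i j \<gamma>. B i j \<gamma> \<in> bounded_ops"
    "\<And>i j X. (\<forall>i. X i \<in> bounded_ops) \<Longrightarrow> M i j X = (\<Sum>\<gamma>\<in>W i j. op_tensor tens (word_op X \<gamma>) (B i j \<gamma>))"
    using assms unfolding op_polynomial_def by metis
  define S where "S = (\<Union>i<q. \<Union>j<q. W i j)"
  define b where "b i j u v \<gamma> = (if \<gamma> \<in> W i j then cinner (blinfun_apply (B i j \<gamma>) (e v)) (e u) else 0)"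
    for i j u v \<gamma>
  define P where "P \<gamma> s t = b (s div r) (t div r) (s mod r) (t mod r) \<gamma>" for \<gamma> s t
  have finS: "finite S" using M by (simp add: S_def)
  have supp: "poly_support (q * r) P \<subseteq> S"
  proof
    fix \<gamma> assume "\<gamma> \<in> poly_support (q * r) P"
    then obtain s t where st: "s < q * r" "t < q * r" "P \<gamma> s t \<noteq> 0" by (auto simp: poly_support_def)
    then have "s div r < q" "t div r < q" by (simp_all add: less_mult_imp_div_less)
    moreover have "\<gamma> \<in> W (s div r) (t div r)" using st by (simp add: P_def b_def split: if_splits)
    ultimately show "\<gamma> \<in> S" by (auto simp: S_def)
  qed
  have "mat_form (q * r) (poly_eval (q * r) P X) \<eta> =
      mat_form q (\<lambda>i j. M i j X) (\<lambda>i. \<Sum>v<r. tens (\<eta> (i * r + v)) (e v))"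
    if X: "\<forall>i. X i \<in> bounded_ops" for X \<eta>
  proof -
    have w: "word_op X \<gamma> \<in> bounded_ops" for \<gamma> using X by (intro word_op_bounded_ops) auto
    define g where "g i j u v \<gamma> = b i j u v \<gamma> * cinner (blinfun_apply (word_op X \<gamma>) (\<eta> (j * r + v))) (\<eta> (i * r + u))"
      for i j u v \<gamma>
    have "mat_form (q * r) (poly_eval (q * r) P X) \<eta> = (\<Sum>s<q * r. \<Sum>t<q * r. \<Sum>\<gamma>\<in>S.
        P \<gamma> s t * cinner (blinfun_apply (word_op X \<gamma>) (\<eta> t)) (\<eta> s))"
      unfolding mat_form_poly_eval using finS supp
      by (intro sum.cong refl sum.mono_neutral_left) (auto simp: poly_support_def)
    also have "\<dots> = (\<Sum>i<q. \<Sum>u<r. \<Sum>j<q. \<Sum>v<r. \<Sum>\<gamma>\<in>S. g i j u v \<gamma>)"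
      unfolding sum_lessThan_mult by (intro sum.cong refl) (simp add: P_def g_def)
    also have "\<dots> = (\<Sum>i<q. \<Sum>j<q. \<Sum>u<r. \<Sum>v<r. \<Sum>\<gamma>\<in>S. g i j u v \<gamma>)"
      by (intro sum.cong refl sum.swap)
    also have "\<dots> = mat_form q (\<lambda>i j. M i j X) (\<lambda>i. \<Sum>v<r. tens (\<eta> (i * r + v)) (e v))"
      unfolding mat_form_def
    proof (intro sum.cong refl)
      fix i j assume ij: "i \<in> {..<q}" "j \<in> {..<q}"
      have "cinner (blinfun_apply (M i j X) (\<Sum>v<r. tens (\<eta> (j * r + v)) (e v))) (\<Sum>u<r. tens (\<eta> (i * r + u)) (e u))
          = (\<Sum>u<r. \<Sum>v<r. cinner (blinfun_apply (M i j X) (tens (\<eta> (j * r + v)) (e v))) (tens (\<eta> (i * r + u)) (e u)))"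
        unfolding blinfun.sum_right cinner.sum_left unfolding cinner.sum_right by (rule sum.swap)
      also have "\<dots> = (\<Sum>u<r. \<Sum>v<r. \<Sum>\<gamma>\<in>W i j. g i j u v \<gamma>)"
        unfolding M(3)[OF X] blinfun.sum_left cinner.sum_left
        by (intro sum.cong refl) (simp add: op_tensor_apply w M cinner_tens g_def b_def)
      also have "\<dots> = (\<Sum>u<r. \<Sum>v<r. \<Sum>\<gamma>\<in>S. g i j u v \<gamma>)"
        using finS ij by (intro sum.cong refl sum.mono_neutral_left) (auto simp: g_def b_def S_def)
      finally show "(\<Sum>u<r. \<Sum>v<r. \<Sum>\<gamma>\<in>S. g i j u v \<gamma>) =
          cinner (blinfun_apply (M i j X) (\<Sum>v<r. tens (\<eta> (j * r + v)) (e v))) (\<Sum>v<r. tens (\<eta> (i * r + v)) (e v))"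
        by simp
    qed
    finally show ?thesis .
  qed
  moreover have "is_nc_poly (q * r) P"
    unfolding is_nc_poly_def using supp finS by (rule finite_subset)
  ultimately show ?thesis by blast
qed

text \<open>The scalar polynomial \<open>P\<close> compressed from \<open>p \<circ> G\<close> has nonnegative real part on the whole ball of
  \<open>H\<close>: each of its forms is a form of \<open>p\<close> at a point \<open>G(Z)\<close> of the closed ball.  So \<open>P\<close> is a
  legitimate test polynomial for \<open>X \<sim>\<^sub>c Y\<close>.\<close>

lemma harnack_op_polynomial:
  fixes G :: "'m::finite \<Rightarrow> ('n::finite \<Rightarrow> 'h \<Rightarrow>\<^sub>L 'h) \<Rightarrow> ('k \<Rightarrow>\<^sub>L 'k)"
  assumes inf: "infinite_dimensional TYPE('h)"
    and G: "\<And>j. op_polynomial (G j)" "\<And>Z. Z \<in> op_ball \<Longrightarrow> (\<lambda>j. G j Z) \<in> op_cball"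
    and XY: "X \<in> op_ball" "Y \<in> op_ball" "harnack_dominated TYPE('h) c X Y"
    and p: "is_nc_poly q p" "poly_Re_nonneg TYPE('h) q p"
    and \<xi>: "\<And>i. i < q \<Longrightarrow> \<xi> i \<in> cspan {tens x y |x y. True}"
  shows "Re (mat_form q (poly_eval q p (\<lambda>j. G j Y)) \<xi>) / c\<^sup>2 \<le> Re (mat_form q (poly_eval q p (\<lambda>j. G j X)) \<xi>)"
    and "Re (mat_form q (poly_eval q p (\<lambda>j. G j X)) \<xi>) \<le> c\<^sup>2 * Re (mat_form q (poly_eval q p (\<lambda>j. G j Y)) \<xi>)"
proof -
  have "\<exists>U. finite U \<and> (\<forall>V. finite V \<longrightarrow> U \<subseteq> V \<longrightarrow> (\<exists>\<eta>. \<xi> i = (\<Sum>u\<in>V. tens (\<eta> u) u)))" if "i < q" for i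
    using span_tens_expansion[OF \<xi>[OF that]] by metis
  then obtain U where U: "\<And>i. i < q \<Longrightarrow> finite (U i)"
    "\<And>i V. i < q \<Longrightarrow> finite V \<Longrightarrow> U i \<subseteq> V \<Longrightarrow> \<exists>\<eta>. \<xi> i = (\<Sum>u\<in>V. tens (\<eta> u) u)"
    by metis
  define V where "V = (\<Union>i<q. U i)"
  have V: "finite V" using U(1) by (simp add: V_def)
  have "\<exists>\<eta>. \<xi> i = (\<Sum>u\<in>V. tens (\<eta> u) u)" if "i < q" for i
    using that V by (intro U(2)) (auto simp: V_def)
  then obtain \<eta> where \<eta>: "\<And>i. i < q \<Longrightarrow> \<xi> i = (\<Sum>u\<in>V. tens (\<eta> i u) u)" by metis
  define r where "r = card V"
  obtain e where e: "bij_betw e {..<r} V"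
    using ex_bij_betw_nat_finite[OF V] by (auto simp: r_def lessThan_atLeast0)
  define \<zeta> where "\<zeta> s = \<eta> (s div r) (e (s mod r))" for s
  have \<xi>_eq: "\<xi> i = (\<Sum>v<r. tens (\<zeta> (i * r + v)) (e v))" if "i < q" for i
  proof -
    have "\<xi> i = (\<Sum>v<r. tens (\<eta> i (e v)) (e v))"
      unfolding \<eta>[OF that] by (rule sum.reindex_bij_betw[OF e, symmetric])
    also have "\<dots> = (\<Sum>v<r. tens (\<zeta> (i * r + v)) (e v))"
      by (intro sum.cong refl) (simp add: \<zeta>_def)
    finally show ?thesis .
  qed
  have "\<exists>P. is_nc_poly (q * r) P \<and> (\<forall>X \<eta>. (\<forall>i. X i \<in> bounded_ops) \<longrightarrow>
     mat_form (q * r) (poly_eval (q * r) P X) \<eta> =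
       mat_form q (\<lambda>i j. poly_eval q p (\<lambda>j. G j X) i j) (\<lambda>i. \<Sum>v<r. tens (\<eta> (i * r + v)) (e v)))"
    by (rule op_polynomial_matrix_compression) (rule op_polynomial_poly_eval[OF G(1)])
  then obtain P where P: "is_nc_poly (q * r) P \<and> (\<forall>X \<eta>. (\<forall>i. X i \<in> bounded_ops) \<longrightarrow>
     mat_form (q * r) (poly_eval (q * r) P X) \<eta> =
       mat_form q (\<lambda>i j. poly_eval q p (\<lambda>j. G j X) i j) (\<lambda>i. \<Sum>v<r. tens (\<eta> (i * r + v)) (e v)))"
    ..
  note P_form = P[THEN conjunct2, rule_format]
  have Ppos: "poly_Re_nonneg TYPE('h) (q * r) P"
    unfolding poly_Re_nonneg_iff
  proof (intro ballI allI)
    fix Z :: "'n \<Rightarrow> 'h \<Rightarrow>\<^sub>L 'h" and \<eta> :: "nat \<Rightarrow> 'h"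
    assume Z: "Z \<in> op_ball"
    then have "\<forall>i. Z i \<in> bounded_ops" by (simp add: op_ball_def)
    then show "0 \<le> Re (mat_form (q * r) (poly_eval (q * r) P Z) \<eta>)"
      using poly_nonneg_on_cball[OF inf p G(2)[OF Z]] by (simp add: P_form)
  qed
  have form: "mat_form q (poly_eval q p (\<lambda>j. G j Z)) \<xi> = mat_form (q * r) (poly_eval (q * r) P Z) \<zeta>"
    if "Z \<in> op_ball" for Z
  proof -
    have "\<forall>i. Z i \<in> bounded_ops" using that by (simp add: op_ball_def)
    then show ?thesis by (simp add: P_form) (simp add: mat_form_def \<xi>_eq)
  qed
  have "Re (mat_form (q * r) (poly_eval (q * r) P Y) \<zeta>) / c\<^sup>2 \<le> Re (mat_form (q * r) (poly_eval (q * r) P X) \<zeta>) \<and>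
      Re (mat_form (q * r) (poly_eval (q * r) P X) \<zeta>) \<le> c\<^sup>2 * Re (mat_form (q * r) (poly_eval (q * r) P Y) \<zeta>)"
    using XY(3) P[THEN conjunct1] Ppos
    unfolding harnack_dominated_iff[OF op_ball_subset_cball[OF XY(1)] op_ball_subset_cball[OF XY(2)]]
    by blast
  then show "Re (mat_form q (poly_eval q p (\<lambda>j. G j Y)) \<xi>) / c\<^sup>2 \<le> Re (mat_form q (poly_eval q p (\<lambda>j. G j X)) \<xi>)"
    "Re (mat_form q (poly_eval q p (\<lambda>j. G j X)) \<xi>) \<le> c\<^sup>2 * Re (mat_form q (poly_eval q p (\<lambda>j. G j Y)) \<xi>)"
    by (simp_all add: form XY)
qed

end


section \<open>Fejer means of free holomorphic functions\<close>

context tensor_product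
begin

definition homogeneous_part :: "('n::finite list \<Rightarrow> 'e \<Rightarrow>\<^sub>L 'e) \<Rightarrow> ('n \<Rightarrow> 'h \<Rightarrow>\<^sub>L 'h) \<Rightarrow> nat \<Rightarrow> ('k \<Rightarrow>\<^sub>L 'k)"
  where "homogeneous_part A X k = (\<Sum>\<alpha> | length \<alpha> = k. op_tensor tens (word_op X \<alpha>) (A \<alpha>))"

definition fejer_mean :: "nat \<Rightarrow> ('n::finite list \<Rightarrow> 'e \<Rightarrow>\<^sub>L 'e) \<Rightarrow> ('n \<Rightarrow> 'h \<Rightarrow>\<^sub>L 'h) \<Rightarrow> ('k \<Rightarrow>\<^sub>L 'k)"
  where "fejer_mean N A X = (\<Sum>k<N. (real (N - k) / real N) *\<^sub>R homogeneous_part A X k)"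

lemma scaleR_op_scaleC: "r *\<^sub>R T = op_scaleC (of_real r) T"
  by (rule blinfun_eqI) (simp add: op_scaleC.rep_eq blinfun.scaleR_left scaleC_of_real)

lemma op_polynomial_fejer_mean:
  assumes "\<And>\<alpha>. A \<alpha> \<in> bounded_ops"
  shows "op_polynomial (fejer_mean N A)"
  unfolding fejer_mean_def[abs_def] homogeneous_part_def scaleR_op_scaleC
  by (intro op_polynomial_sum op_polynomial_scaleC op_polynomial_monom assms)

lemma homogeneous_part_bounded_ops:
  assumes "\<And>\<alpha>. A \<alpha> \<in> bounded_ops" "\<And>i. X i \<in> bounded_ops"
  shows "homogeneous_part A X k \<in> bounded_ops"
  unfolding homogeneous_part_def
  by (intro sum_bounded_ops op_tensor_bounded_ops word_op_bounded_ops assms)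

lemma homogeneous_part_scaled:
  assumes "\<And>\<alpha>. A \<alpha> \<in> bounded_ops" "\<And>i. X i \<in> bounded_ops"
  shows "blinfun_apply (homogeneous_part A (\<lambda>i. op_scaleC z (X i)) k) \<xi>
    = scaleC (z ^ k) (blinfun_apply (homogeneous_part A X k) \<xi>)"
proof -
  have "homogeneous_part A (\<lambda>i. op_scaleC z (X i)) k
      = (\<Sum>\<alpha> | length \<alpha> = k. op_scaleC (z ^ k) (op_tensor tens (word_op X \<alpha>) (A \<alpha>)))"
    unfolding homogeneous_part_def
    by (intro sum.cong refl)
      (simp add: word_op_scaled assms op_tensor_scaleC word_op_bounded_ops)
  then show ?thesis
    by (simp add: homogeneous_part_def blinfun.sum_left op_scaleC.rep_eq scaleC.sum_right)
qed

text \<open>Fix vectors \<open>\<xi>\<^sub>j\<close> and \<open>\<eta>\<close>, and let \<open>l\<close> be the norm of \<open>\<xi>\<close>.  That \<open>F\<close> is contractive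
  along the circle \<open>zX\<close>, \<open>|z| = 1\<close>, says that the scalar function \<open>l \<parallel>\<eta>\<parallel> - \<Sum>\<^sub>j \<langle>F\<^sub>j(zX) \<xi>\<^sub>j, \<eta>\<rangle>\<close> has
  nonnegative real part there.  Its Fejer means inherit this at \<open>z = 1\<close>, and the choice
  \<open>\<eta> = \<Sum>\<^sub>j G\<^sub>j \<xi>\<^sub>j\<close>, where \<open>G\<^sub>j\<close> is the Fejer mean of \<open>F\<^sub>j\<close> at \<open>X\<close>, turns it into
  \<open>\<parallel>\<eta>\<parallel>\<^sup>2 \<le> l \<parallel>\<eta>\<parallel>\<close>.\<close>

lemma fejer_mean_row_contraction:
  fixes A :: "'m::finite \<Rightarrow> 'n::finite list \<Rightarrow> 'e \<Rightarrow>\<^sub>L 'e"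
  assumes A: "\<And>j \<alpha>. A j \<alpha> \<in> bounded_ops"
    and F: "\<And>j X. X \<in> op_ball \<Longrightarrow> homogeneous_part (A j) X sums F j X"
    and contr: "\<And>X. X \<in> op_ball \<Longrightarrow> row_bound 1 (\<lambda>j. F j X)"
    and X: "X \<in> op_ball"
  shows "row_bound 1 (\<lambda>j. fejer_mean N (A j) X)"
  unfolding row_bound_def
proof
  fix \<xi> :: "'m \<Rightarrow> 'k"
  have bX: "\<And>i. X i \<in> bounded_ops" using X by (simp add: op_ball_def)
  define l where "l = L2_set (\<lambda>j. norm (\<xi> j)) UNIV"
  define \<eta> where "\<eta> = (\<Sum>j\<in>UNIV. blinfun_apply (fejer_mean N (A j) X) (\<xi> j))"
  define g where "g k = (\<Sum>j\<in>UNIV. cinner (blinfun_apply (homogeneous_part (A j) X k) (\<xi> j)) \<eta>)" for k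
  define a where "a k = (if k = 0 then of_real (l * norm \<eta>) else 0) - g k" for k
  obtain R where R: "R > 1" and ball: "\<And>z. cmod z \<le> R \<Longrightarrow> (\<lambda>i. op_scaleC z (X i)) \<in> op_ball"
    using op_ball_expand[OF X] by metis
  have g_sums: "(\<lambda>k. g k * z ^ k) sums
      cinner (\<Sum>j\<in>UNIV. blinfun_apply (F j (\<lambda>i. op_scaleC z (X i))) (\<xi> j)) \<eta>" if "cmod z \<le> R" for z
  proof -
    have "(\<lambda>k. \<Sum>j\<in>UNIV. cinner (blinfun_apply (homogeneous_part (A j) (\<lambda>i. op_scaleC z (X i)) k) (\<xi> j)) \<eta>)
        sums (\<Sum>j\<in>UNIV. cinner (blinfun_apply (F j (\<lambda>i. op_scaleC z (X i))) (\<xi> j)) \<eta>)"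
      by (intro sums_sum bounded_linear.sums[OF cinner.bounded_linear_left]
          bounded_linear.sums[OF blinfun.bounded_linear_left] F ball that)
    then show ?thesis
      by (simp add: homogeneous_part_scaled A bX cinner_scaleC_left g_def cinner.sum_left
          sum_distrib_left mult.commute)
  qed
  \<comment> \<open>convergence at the radius \<open>R > 1\<close> gives absolute convergence on the unit circle\<close>
  have "summable (\<lambda>k. cmod (g k * 1 ^ k))"
  proof (rule powser_insidea)
    show "summable (\<lambda>k. g k * of_real R ^ k)"
      by (rule sums_summable[OF g_sums]) (use R in simp)
    show "cmod 1 < cmod (complex_of_real R)" using R by simp
  qed
  then have g_sum: "summable (\<lambda>k. cmod (g k))" by simp
  have a_sum: "summable (\<lambda>k. cmod (a k))"
  proof (rule summable_comparison_test')
    show "summable (\<lambda>k. (if k = 0 then l * norm \<eta> else 0) + cmod (g k))"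
      by (intro summable_add g_sum sums_summable[OF sums_single])
    show "norm (cmod (a k)) \<le> (if k = 0 then l * norm \<eta> else 0) + cmod (g k)" if "k \<ge> 0" for k
    proof -
      have "0 \<le> l * norm \<eta>" by (simp add: l_def L2_set_nonneg)
      then have "cmod (if k = 0 then of_real (l * norm \<eta>) else 0) = (if k = 0 then l * norm \<eta> else 0)"
        by (cases "k = 0") (simp_all only: simp_thms if_True if_False norm_of_real norm_zero abs_of_nonneg)
      then show ?thesis
        using norm_triangle_ineq4[of "if k = 0 then complex_of_real (l * norm \<eta>) else 0" "g k"]
        unfolding a_def by (simp only: real_norm_def abs_norm_cancel)
    qed
  qed
  have "0 \<le> (\<Sum>k<N. real (N - k) * Re (a k))"
  proof (rule fejer_power_series[OF a_sum])
    fix z :: complex assume z: "cmod z = 1"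
    let ?v = "\<Sum>j\<in>UNIV. blinfun_apply (F j (\<lambda>i. op_scaleC z (X i))) (\<xi> j)"
    have zR: "cmod z \<le> R" using z R by simp
    have "(\<lambda>k. (if k = 0 then of_real (l * norm \<eta>) * z ^ k else 0) - g k * z ^ k) sums
        (of_real (l * norm \<eta>) * z ^ 0 - cinner ?v \<eta>)"
      by (intro sums_diff sums_single g_sums zR)
    also have "(\<lambda>k. (if k = 0 then of_real (l * norm \<eta>) * z ^ k else 0) - g k * z ^ k) = (\<lambda>k. a k * z ^ k)"
      by (auto simp: a_def left_diff_distrib)
    finally have eq: "(\<Sum>k. a k * z ^ k) = of_real (l * norm \<eta>) - cinner ?v \<eta>"
      by (simp add: sums_iff)
    have "Re (cinner ?v \<eta>) \<le> norm ?v * norm \<eta>" by (rule Re_cinner_le_norm)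
    also have "\<dots> \<le> l * norm \<eta>"
      using contr[OF ball[OF zR], unfolded row_bound_def, THEN spec, of \<xi>]
      by (intro mult_right_mono) (auto simp: l_def)
    finally show "0 \<le> Re (\<Sum>k. a k * z ^ k)" by (simp add: eq)
  qed
  also have "\<dots> = (\<Sum>k<N. (if k = 0 then real N * (l * norm \<eta>) else 0) - real (N - k) * Re (g k))"
    by (intro sum.cong refl) (auto simp: a_def right_diff_distrib)
  also have "\<dots> = (if N = 0 then 0 else real N * (l * norm \<eta>)) - (\<Sum>k<N. real (N - k) * Re (g k))"
    by (simp add: sum_subtractf)
  also have "(\<Sum>k<N. real (N - k) * Re (g k)) = real N * (norm \<eta>)\<^sup>2"
  proof -
    have "real N * (norm \<eta>)\<^sup>2 = real N * Re (cinner (\<Sum>j\<in>UNIV. blinfun_apply (fejer_mean N (A j) X) (\<xi> j)) \<eta>)"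
      by (simp add: Re_cinner_self flip: \<eta>_def)
    also have "\<dots> = real N * (\<Sum>j\<in>UNIV. \<Sum>k<N. (real (N - k) / real N) *
        Re (cinner (blinfun_apply (homogeneous_part (A j) X k) (\<xi> j)) \<eta>))"
      by (simp only: fejer_mean_def cinner.sum_left blinfun.sum_left blinfun.scaleR_left
          cinner.scaleR_left Re_sum scaleR_complex.sel)
    also have "\<dots> = real N * (\<Sum>k<N. (real (N - k) / real N) * Re (g k))"
      unfolding g_def Re_sum by (subst sum.swap) (simp only: sum_distrib_left)
    also have "\<dots> = (\<Sum>k<N. real (N - k) * Re (g k))"
      unfolding sum_distrib_left by (intro sum.cong refl) auto
    finally show ?thesis by simp
  qed
  finally have le: "real N * (norm \<eta>)\<^sup>2 \<le> (if N = 0 then 0 else real N * (l * norm \<eta>))" by simp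
  have "norm \<eta> \<le> l"
  proof (cases "N = 0")
    case True
    then show ?thesis by (simp add: \<eta>_def fejer_mean_def l_def L2_set_nonneg)
  next
    case False
    then have "(norm \<eta>)\<^sup>2 \<le> l * norm \<eta>" using le by simp
    then show ?thesis by (rule le_of_sq_le_mult) (simp add: l_def L2_set_nonneg)
  qed
  then show "norm (\<Sum>j\<in>UNIV. blinfun_apply (fejer_mean N (A j) X) (\<xi> j)) \<le> 1 * L2_set (\<lambda>j. norm (\<xi> j)) UNIV"
    by (simp add: \<eta>_def l_def)
qed

text \<open>The constant \<open>c\<close> is unchanged.  Two limits are taken: in the order of the Fejer means for
  fixed vectors in the span of the elementary tensors, and then in the vectors.\<close>

lemma harnack_dominated_free_holomorphic:
  fixes F :: "'m::finite \<Rightarrow> ('n::finite \<Rightarrow> 'h \<Rightarrow>\<^sub>L 'h) \<Rightarrow> ('k \<Rightarrow>\<^sub>L 'k)"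
  assumes inf: "infinite_dimensional TYPE('h)"
    and F: "\<And>j. free_holomorphic tens (F j)" and contr: "sup_row_norm F \<le> 1"
    and X: "X \<in> op_ball" and Y: "Y \<in> op_ball"
    and dom: "harnack_dominated TYPE('h) c X Y"
  shows "harnack_dominated TYPE('h) c (\<lambda>j. F j X) (\<lambda>j. F j Y)"
proof -
  have "\<forall>j. \<exists>A. (\<forall>\<alpha>. A \<alpha> \<in> bounded_ops) \<and> (\<forall>X\<in>op_ball. homogeneous_part A X sums F j X)"
    using F unfolding free_holomorphic_def homogeneous_part_def[abs_def] by blast
  then obtain A where "\<forall>j. (\<forall>\<alpha>. A j \<alpha> \<in> bounded_ops) \<and> (\<forall>X\<in>op_ball. homogeneous_part (A j) X sums F j X)"
    by (rule choice[THEN exE])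
  then have A: "\<And>j \<alpha>. A j \<alpha> \<in> bounded_ops"
    and sums: "\<And>j X. X \<in> op_ball \<Longrightarrow> homogeneous_part (A j) X sums F j X"
    by blast+
  have F_ops: "F j Z \<in> bounded_ops" if Z: "Z \<in> op_ball" for j Z
  proof (rule closed_sequentially[OF closed_bounded_ops])
    show "(\<lambda>n. \<Sum>k<n. homogeneous_part (A j) Z k) \<longlonglongrightarrow> F j Z"
      using sums[OF Z] by (simp add: sums_def)
    show "(\<Sum>k<n. homogeneous_part (A j) Z k) \<in> bounded_ops" for n
      using Z by (intro sum_bounded_ops homogeneous_part_bounded_ops A) (simp add: op_ball_def)
  qed
  have F_cball: "(\<lambda>j. F j Z) \<in> op_cball" if Z: "Z \<in> op_ball" for Z
  proof -
    have "ereal (row_norm (\<lambda>j. F j Z)) \<le> sup_row_norm F"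
      unfolding sup_row_norm_def using Z by (rule SUP_upper)
    then have "ereal (row_norm (\<lambda>j. F j Z)) \<le> ereal 1"
      using contr by (metis one_ereal_def order_trans)
    then show ?thesis using F_ops[OF Z] by (simp add: op_cball_def)
  qed
  define G where "G N j = fejer_mean N (A j)" for N j
  have G_poly: "op_polynomial (G N j)" for N j
    unfolding G_def by (intro op_polynomial_fejer_mean A)
  have G_cball: "(\<lambda>j. G N j Z) \<in> op_cball" if Z: "Z \<in> op_ball" for N Z
    unfolding op_cball_iff
  proof (intro conjI allI)
    show "row_bound 1 (\<lambda>j. G N j Z)"
      unfolding G_def using F_cball Z
      by (intro fejer_mean_row_contraction[where F = F] A sums) (auto simp: op_cball_iff)
    show "G N j Z \<in> bounded_ops" for j
      unfolding G_def fejer_mean_def using Z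
      by (intro sum_bounded_ops scaleR_bounded_ops homogeneous_part_bounded_ops A) (simp add: op_ball_def)
  qed
  have G_lim: "(\<lambda>N. G N j Z) \<longlonglongrightarrow> F j Z" if "Z \<in> op_ball" for j Z
    unfolding G_def fejer_mean_def by (intro tendsto_fejer_mean sums that)
  have c: "c \<ge> 1" using dom by (simp add: harnack_dominated_def)
  have "Re (mat_form q (poly_eval q p (\<lambda>j. F j Y)) \<xi>) / c\<^sup>2 \<le> Re (mat_form q (poly_eval q p (\<lambda>j. F j X)) \<xi>) \<and>
      Re (mat_form q (poly_eval q p (\<lambda>j. F j X)) \<xi>) \<le> c\<^sup>2 * Re (mat_form q (poly_eval q p (\<lambda>j. F j Y)) \<xi>)"
    if p: "is_nc_poly q p" "poly_Re_nonneg TYPE('h) q p" for q p \<xi>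
  proof -
    let ?D = "cspan {tens x y |x y. True}"
    let ?form = "\<lambda>T \<xi>. Re (mat_form q (poly_eval q p T) \<xi>)"
    have lim: "(\<lambda>N. ?form (\<lambda>j. G N j Z) \<zeta>) \<longlonglongrightarrow> ?form (\<lambda>j. F j Z) \<zeta>" if "Z \<in> op_ball" for Z \<zeta>
      by (intro tendsto_Re tendsto_mat_form tendsto_const G_lim that)
    have dense_case: "?form (\<lambda>j. F j Y) \<zeta> / c\<^sup>2 \<le> ?form (\<lambda>j. F j X) \<zeta> \<and>
        ?form (\<lambda>j. F j X) \<zeta> \<le> c\<^sup>2 * ?form (\<lambda>j. F j Y) \<zeta>" if \<zeta>: "\<And>i. \<zeta> i \<in> ?D" for \<zeta>
    proof
      note step = harnack_op_polynomial[OF inf G_poly G_cball X Y dom p \<zeta>]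
      have c2: "c\<^sup>2 \<noteq> 0" using c by simp
      show "?form (\<lambda>j. F j Y) \<zeta> / c\<^sup>2 \<le> ?form (\<lambda>j. F j X) \<zeta>"
        using step(1) by (intro LIMSEQ_le[OF tendsto_divide[OF lim[OF Y] tendsto_const c2] lim[OF X]]) auto
      show "?form (\<lambda>j. F j X) \<zeta> \<le> c\<^sup>2 * ?form (\<lambda>j. F j Y) \<zeta>"
        using step(2) by (intro LIMSEQ_le[OF lim[OF X] tendsto_mult[OF tendsto_const lim[OF Y]]]) auto
    qed
    have "\<exists>s. (\<forall>n. s n \<in> ?D) \<and> s \<longlonglongrightarrow> \<xi> i" for i
      using tens_dense closure_sequential[of "\<xi> i" ?D] by auto
    then obtain s where s: "\<And>i n. s i n \<in> ?D" "\<And>i. s i \<longlonglongrightarrow> \<xi> i" by metis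
    have lim': "(\<lambda>n. ?form T (\<lambda>i. s i n)) \<longlonglongrightarrow> ?form T \<xi>" for T :: "'m \<Rightarrow> 'k \<Rightarrow>\<^sub>L 'k"
      by (intro tendsto_Re tendsto_mat_form tendsto_const s)
    have c2: "c\<^sup>2 \<noteq> 0" using c by simp
    show ?thesis
    proof
      show "?form (\<lambda>j. F j Y) \<xi> / c\<^sup>2 \<le> ?form (\<lambda>j. F j X) \<xi>"
        using dense_case[OF s(1)]
        by (intro LIMSEQ_le[OF tendsto_divide[OF lim' tendsto_const c2] lim']) auto
      show "?form (\<lambda>j. F j X) \<xi> \<le> c\<^sup>2 * ?form (\<lambda>j. F j Y) \<xi>"
        using dense_case[OF s(1)]
        by (intro LIMSEQ_le[OF lim' tendsto_mult[OF tendsto_const lim']]) auto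
    qed
  qed
  then show ?thesis
    unfolding harnack_dominated_iff[OF F_cball[OF X] F_cball[OF Y]] using c by blast
qed

end

lemma pseudohyperbolic_mono:
  assumes "1 \<le> harnack_omega H A B" "harnack_omega H A B \<le> harnack_omega H' A' B'"
  shows "pseudohyperbolic H A B \<le> pseudohyperbolic H' A' B'"
proof -
  have eq: "(t - 1) / (t + 1) = 1 - 2 / (t + 1)" if "t \<ge> 1" for t :: real
    using that by (simp add: field_simps)
  define s t where "s = (harnack_omega H A B)\<^sup>2" and "t = (harnack_omega H' A' B')\<^sup>2"
  have "1 \<le> s" "s \<le> t"
    using assms by (auto simp: s_def t_def intro: power_mono)
  moreover from this have "2 / (t + 1) \<le> 2 / (s + 1)" by (intro divide_left_mono) auto
  ultimately show ?thesis
    unfolding pseudohyperbolic_def s_def[symmetric] t_def[symmetric] by (simp add: eq)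
qed

theorem theorem9p3:
  fixes tens :: "'h::chilbert_space \<Rightarrow> 'e::chilbert_space \<Rightarrow> 'k::chilbert_space"
    and F :: "'m::finite \<Rightarrow> ('n::finite \<Rightarrow> 'h \<Rightarrow>\<^sub>L 'h) \<Rightarrow> ('k \<Rightarrow>\<^sub>L 'k)"
    and X Y :: "'n \<Rightarrow> 'h \<Rightarrow>\<^sub>L 'h"
  assumes "\<exists>D::'h set. countable D \<and> closure D = UNIV"
    and "infinite_dimensional TYPE('h)"
    and "hilbert_tensor tens"
    and "\<And>j. free_holomorphic tens (F j)"
    and "sup_row_norm F \<le> 1"
    and "X \<in> op_ball" and "Y \<in> op_ball"
  shows "harnack_equivalent TYPE('h) (\<lambda>j. F j X) (\<lambda>j. F j Y) \<and>
    pseudohyperbolic TYPE('h) (\<lambda>j. F j X) (\<lambda>j. F j Y) \<le> pseudohyperbolic TYPE('h) X Y"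
proof -
  interpret tensor_product tens by unfold_locales fact
  let ?S = "{c. c \<ge> 1 \<and> harnack_dominated TYPE('h) c X Y}"
  let ?S' = "{c. c \<ge> 1 \<and> harnack_dominated TYPE('h) c (\<lambda>j. F j X) (\<lambda>j. F j Y)}"
  have sub: "?S \<subseteq> ?S'"
    using harnack_dominated_free_holomorphic[OF assms(2,4-7)] by auto
  obtain c where c: "c \<in> ?S"
    using op_ball_harnack_dominated[OF assms(6,7)] by auto
  then have "c \<in> ?S'" using sub by blast
  moreover have "1 \<le> Inf ?S'"
    using \<open>c \<in> ?S'\<close> by (intro cInf_greatest) auto
  moreover have "Inf ?S' \<le> Inf ?S"
    using c sub by (intro cInf_superset_mono) (auto intro: bdd_belowI[of _ 1])
  ultimately show ?thesis
    by (auto simp: harnack_equivalent_def harnack_omega_def intro!: pseudohyperbolic_mono)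
qed

end
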